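(* Let $n\ge4$. The circuit variety of $L_n$ has the irredundant irreducible decomposition $$V_{\mathcal{C}(L_n)}=\bigcup_{\mathcal{Q}}V_{L_n(\mathcal{Q})},$$ where the union ranges over all partitions $\mathcal{Q}=\{Q_1,\ldots,Q_k\}$ of the set $\mathcal{L}$ of lines of $L_n$ such that $|Q_i|\notin\{2,3,n-1\}$ for every $i\in[k]$.
   Context: $L_n$ is the rank-three paving matroid on the set $P$ of 2-element subsets of $[n]$ (the pairwise intersection points of $n$ general lines in $\mathbb{P}^2$), whose lines are $\ell_i=\{\{i,j\}:j\ne i\}$, $i\in[n]$, $\mathcal{L}=\{\ell_1,\ldots,\ell_n\}$; circuits are the 3-subsets of some $\ell_i$ and the 4-subsets containing no such 3-subset. For a partition $\mathcal{Q}=\{Q_1,\ldots,Q_k\}$ of $\mathcal{L}$, let $H_i=\bigcup_{\ell\in Q_i}\ell$ and let $L_n(\mathcal{Q})$ be the matroid on $P$ whose circuits are: (Type 1) 2-subsets contained in $H_i\cap H_j$ for some $i\ne j$; (Type 2) 3-subsets of some $H_i$ containing no Type 1 set; (Type 3) 4-subsets containing no Type 1 or Type 2 set. For a matroid $N$ on $P$, the circuit variety $V_{\mathcal{C}(N)}$ is the set of tuples $(\gamma_p)_{p\in P}$ in $\mathbb{C}^3$ with $(\gamma_p)_{p\in S}$ linearly dependent for every dependent $S$; a realization is a tuple with $(\gamma_p)_{p\in S}$ dependent iff $S$ is dependent in $N$, and $V_N$ is the Zariski closure of the set of realizations. Irredundant: each component is irreducible and none is contained in another. *)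

theory Defs
  imports "HOL-Analysis.Analysis" "HOL-Library.Disjoint_Sets"
begin

definition pts :: "nat \<Rightarrow> nat set set" where
  "pts n = {S. S \<subseteq> {1..n} \<and> card S = 2}"

definition line :: "nat \<Rightarrow> nat \<Rightarrow> nat set set" where
  "line n i = {S \<in> pts n. i \<in> S}"

definition lines :: "nat \<Rightarrow> nat set set set" where
  "lines n = line n ` {1..n}"

definition circuit_L :: "nat \<Rightarrow> nat set set \<Rightarrow> bool" where
  "circuit_L n C \<longleftrightarrow> C \<subseteq> pts n \<and>
     ((card C = 3 \<and> (\<exists>l\<in>lines n. C \<subseteq> l)) \<or>
      (card C = 4 \<and> \<not> (\<exists>T\<subseteq>C. card T = 3 \<and> (\<exists>l\<in>lines n. T \<subseteq> l))))"

text \<open>For a partition Q of the lines, the sets H are the unions of the blocks.\<close>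

definition type1 :: "nat \<Rightarrow> nat set set set set \<Rightarrow> nat set set \<Rightarrow> bool" where
  "type1 n Q C \<longleftrightarrow> C \<subseteq> pts n \<and> card C = 2 \<and>
     (\<exists>A\<in>Q. \<exists>B\<in>Q. A \<noteq> B \<and> C \<subseteq> \<Union>A \<inter> \<Union>B)"

definition type2 :: "nat \<Rightarrow> nat set set set set \<Rightarrow> nat set set \<Rightarrow> bool" where
  "type2 n Q C \<longleftrightarrow> C \<subseteq> pts n \<and> card C = 3 \<and> (\<exists>A\<in>Q. C \<subseteq> \<Union>A) \<and>
     \<not> (\<exists>D\<subseteq>C. type1 n Q D)"

definition type3 :: "nat \<Rightarrow> nat set set set set \<Rightarrow> nat set set \<Rightarrow> bool" where
  "type3 n Q C \<longleftrightarrow> C \<subseteq> pts n \<and> card C = 4 \<and>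
     \<not> (\<exists>D\<subseteq>C. type1 n Q D \<or> type2 n Q D)"

definition circuit_LQ :: "nat \<Rightarrow> nat set set set set \<Rightarrow> nat set set \<Rightarrow> bool" where
  "circuit_LQ n Q C \<longleftrightarrow> type1 n Q C \<or> type2 n Q C \<or> type3 n Q C"

definition dep_of :: "nat \<Rightarrow> (nat set set \<Rightarrow> bool) \<Rightarrow> nat set set \<Rightarrow> bool" where
  "dep_of n circ S \<longleftrightarrow> S \<subseteq> pts n \<and> (\<exists>C\<subseteq>S. circ C)"

text \<open>The ambient space (C^3)^P: functions vanishing outside P.\<close>

definition ambient :: "nat \<Rightarrow> (nat set \<Rightarrow> complex^3) set" where
  "ambient n = {\<gamma>. \<forall>p. p \<notin> pts n \<longrightarrow> \<gamma> p = 0}"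

text \<open>Linear dependence of the family (\<gamma> p) for p in S (as a family, repetitions count).\<close>

definition lin_dep_fam :: "(nat set \<Rightarrow> complex^3) \<Rightarrow> nat set set \<Rightarrow> bool" where
  "lin_dep_fam \<gamma> S \<longleftrightarrow> (\<exists>c. (\<exists>p\<in>S. c p \<noteq> 0) \<and> (\<Sum>p\<in>S. c p *s \<gamma> p) = 0)"

definition circuit_variety :: "nat \<Rightarrow> (nat set set \<Rightarrow> bool) \<Rightarrow> (nat set \<Rightarrow> complex^3) set" where
  "circuit_variety n dep = {\<gamma> \<in> ambient n. \<forall>S. dep S \<longrightarrow> lin_dep_fam \<gamma> S}"

definition realizations :: "nat \<Rightarrow> (nat set set \<Rightarrow> bool) \<Rightarrow> (nat set \<Rightarrow> complex^3) set" where
  "realizations n dep = {\<gamma> \<in> ambient n. \<forall>S\<subseteq>pts n. lin_dep_fam \<gamma> S \<longleftrightarrow> dep S}"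

inductive_set poly_fun :: "((nat set \<Rightarrow> complex^3) \<Rightarrow> complex) set" where
  pconst: "(\<lambda>\<gamma>. c) \<in> poly_fun"
| pcoord: "(\<lambda>\<gamma>. \<gamma> p $ i) \<in> poly_fun"
| padd: "f \<in> poly_fun \<Longrightarrow> g \<in> poly_fun \<Longrightarrow> (\<lambda>\<gamma>. f \<gamma> + g \<gamma>) \<in> poly_fun"
| pmult: "f \<in> poly_fun \<Longrightarrow> g \<in> poly_fun \<Longrightarrow> (\<lambda>\<gamma>. f \<gamma> * g \<gamma>) \<in> poly_fun"

definition zclosed :: "nat \<Rightarrow> (nat set \<Rightarrow> complex^3) set \<Rightarrow> bool" where
  "zclosed n X \<longleftrightarrow> (\<exists>F\<subseteq>poly_fun. X = {\<gamma> \<in> ambient n. \<forall>f\<in>F. f \<gamma> = 0})"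

definition zclosure :: "nat \<Rightarrow> (nat set \<Rightarrow> complex^3) set \<Rightarrow> (nat set \<Rightarrow> complex^3) set" where
  "zclosure n S = \<Inter>{X. zclosed n X \<and> S \<subseteq> X}"

definition zirreducible :: "nat \<Rightarrow> (nat set \<Rightarrow> complex^3) set \<Rightarrow> bool" where
  "zirreducible n X \<longleftrightarrow> zclosed n X \<and> X \<noteq> {} \<and>
     (\<forall>A B. zclosed n A \<longrightarrow> zclosed n B \<longrightarrow> X \<subseteq> A \<union> B \<longrightarrow> X \<subseteq> A \<or> X \<subseteq> B)"

definition V_circ_L :: "nat \<Rightarrow> (nat set \<Rightarrow> complex^3) set" where
  "V_circ_L n = circuit_variety n (dep_of n (circuit_L n))"

definition V_LQ :: "nat \<Rightarrow> nat set set set set \<Rightarrow> (nat set \<Rightarrow> complex^3) set" where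
  "V_LQ n Q = zclosure n (realizations n (dep_of n (circuit_LQ n Q)))"

definition admissible :: "nat \<Rightarrow> nat set set set set \<Rightarrow> bool" where
  "admissible n Q \<longleftrightarrow> partition_on (lines n) Q \<and> (\<forall>A\<in>Q. card A \<notin> {2, 3, n - 1})"

end

theory Submission
  imports Defs "HOL-Computational_Algebra.Polynomial"
begin

text \<open>A tuple \<open>\<gamma>\<close> lies in the circuit variety iff for each line \<open>i\<close> there is a nonzero covector
  \<open>f i\<close> annihilating all \<open>\<gamma> {i, j}\<close>. Grouping the lines by proportionality of \<open>f\<close> gives an
  equivalence relation \<open>R\<close> and exhibits \<open>\<gamma>\<close> as a value of a polynomial map: \<open>\<gamma> {i, j}\<close> is a
  multiple of \<open>f i \<times> f j\<close> if \<open>i\<close>, \<open>j\<close> are inequivalent, and \<open>f i \<times> u\<close> with free \<open>u\<close> otherwise. Hence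
  the circuit variety is the union of the irreducible closures of the images of these maps.
  A class of size 2 or 3 can be split into singletons by moving \<open>f i\<close> to \<open>f i + t v i\<close> and letting
  \<open>t\<close> tend to 0, and a class of size \<open>n - 1\<close> forces all points onto one line, so the remaining
  relations suffice. They are irredundant because the lines of a generic point determine \<open>R\<close>, except
  that a class of at least four lines could be a limit of distinct lines; this is excluded by the
  quadrilateral-set relation between the six intersection points of four lines.
  All density and irreducibility arguments reduce to univariate polynomials along curves.\<close>

section \<open>Cross products and linear dependence of families\<close>

text \<open>Why sizes 2 and 3 split and larger ones do not: to first order in \<open>t\<close> the
  lines \<open>f + t v j\<close> and \<open>f + t v k\<close> meet in
  \<open>ccross f (v k - v j)\<close>, so the limit points are the directions of the edges of the
  complete graph on the points \<open>v j\<close> of the plane of covectors modulo \<open>f\<close>.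
  One direction is arbitrary, and so are the three directions of a triangle if they are distinct,
  but the six directions of four points obey a relation. The size \<open>n - 1\<close> is of another
  kind: a singleton beside a class of size \<open>n - 1\<close> is the only case in which two
  inequivalent lines never carry three independent points. The components are closures of sets of
  realizations, which leaves two gaps to the polynomial maps. A realization must have
  nonproportional covectors on different blocks, and a generic value of the map must have no
  dependencies beyond the circuits. The second is solved by colouring: the lines are specialised to
  three coordinate lines so that three given points become the vertices of the coordinate
  triangle.\<close>

definition ccross :: "'a::field^3 \<Rightarrow> 'a^3 \<Rightarrow> 'a^3" where
  "ccross a b = vector [a$2 * b$3 - a$3 * b$2, a$3 * b$1 - a$1 * b$3, a$1 * b$2 - a$2 * b$1]"

definition cdot :: "'a::field^3 \<Rightarrow> 'a^3 \<Rightarrow> 'a" where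
  "cdot a b = a$1 * b$1 + a$2 * b$2 + a$3 * b$3"

definition triple :: "'a::field^3 \<Rightarrow> 'a^3 \<Rightarrow> 'a^3 \<Rightarrow> 'a" where
  "triple a b c = cdot (ccross a b) c"

lemma vec3_eq_iff: "(v::'a^3) = w \<longleftrightarrow> v$1 = w$1 \<and> v$2 = w$2 \<and> v$3 = w$3"
  by (simp add: vec_eq_iff forall_3)

lemma ccross_nth [simp]:
  "ccross a b $ 1 = a$2 * b$3 - a$3 * b$2"
  "ccross a b $ 2 = a$3 * b$1 - a$1 * b$3"
  "ccross a b $ 3 = a$1 * b$2 - a$2 * b$1"
  by (simp_all add: ccross_def)

lemmas vec3_simps = vec3_eq_iff cdot_def triple_def

lemma ccross_self [simp]: "ccross a a = 0"
  by (simp add: vec3_simps)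

lemma ccross_zero [simp]: "ccross 0 a = 0" "ccross a 0 = 0"
  by (simp_all add: vec3_simps)

lemma ccross_anticomm: "ccross a b = - ccross b a"
  by (simp add: vec3_simps)

lemma ccross_scale: "ccross (s *s a) b = s *s ccross a b" "ccross a (s *s b) = s *s ccross a b"
  by (simp_all add: vec3_simps algebra_simps)

lemma ccross_linear:
  "ccross (a + b) c = ccross a c + ccross b c" "ccross c (a + b) = ccross c a + ccross c b"
  "ccross (a - b) c = ccross a c - ccross b c" "ccross c (a - b) = ccross c a - ccross c b"
  by (simp_all add: vec3_simps algebra_simps)

lemma cdot_ccross [simp]: "cdot a (ccross a b) = 0" "cdot b (ccross a b) = 0"
  by (simp_all add: vec3_simps algebra_simps)

lemma cdot_scale: "cdot (s *s a) b = s * cdot a b" "cdot a (s *s b) = s * cdot a b"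
  by (simp_all add: vec3_simps algebra_simps)

lemma cdot_zero [simp]: "cdot a 0 = 0" "cdot 0 a = 0"
  by (simp_all add: cdot_def)

text \<open>Cramer's rule with the denominator cleared, so that it survives for dependent
  \<open>a\<close>, \<open>b\<close>, \<open>c\<close>, where it becomes an explicit linear relation
  among them with coefficients governed by an auxiliary \<open>x\<close>.\<close>

lemma cramer3:
  "triple b c x *s a - triple a c x *s b + triple a b x *s c = triple a b c *s (x::'a::field^3)"
  by (simp add: vec3_simps, intro conjI; algebra)

lemma ccross_ccross: "ccross v (ccross f g) = cdot v g *s f - cdot v f *s g"
  by (simp add: vec3_simps, intro conjI; algebra)

lemma cdot_commute: "cdot a b = cdot b a"
  by (simp add: cdot_def mult.commute)

lemma triple_self [simp]: "triple a a b = 0" "triple a b a = 0" "triple b a a = 0"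
  by (simp_all add: vec3_simps algebra_simps)

lemma triple_zero [simp]: "triple 0 a b = 0" "triple a 0 b = 0" "triple a b 0 = 0"
  by (simp_all add: vec3_simps)

text \<open>Expanding \<open>f\<close> in the basis dual to \<open>a\<close>, \<open>b\<close>,
  \<open>c\<close>, with the determinant cleared, leaves only coefficients that vanish.\<close>

lemma triple_eq_0_of_orthogonal:
  assumes "f \<noteq> 0" "cdot f a = 0" "cdot f b = 0" "cdot f c = 0"
  shows "triple a b c = 0"
proof -
  have "triple a b c *s f = cdot f a *s ccross b c + cdot f b *s ccross c a + cdot f c *s ccross a b"
    by (simp add: vec3_simps, intro conjI; algebra)
  then show ?thesis using assms by simp
qed

lemma parallel_of_ccross_eq_0:
  assumes "a \<noteq> 0" "ccross a b = 0"
  obtains s where "b = s *s a"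
proof -
  from assms(1) consider "a$1 \<noteq> 0" | "a$2 \<noteq> 0" | "a$3 \<noteq> 0" by (auto simp: vec3_eq_iff)
  then show ?thesis
  proof cases
    case 1
    show ?thesis by (rule that[of "b$1 / a$1"]) (use assms 1 in \<open>auto simp: vec3_simps field_simps\<close>)
  next
    case 2
    show ?thesis by (rule that[of "b$2 / a$2"]) (use assms 2 in \<open>auto simp: vec3_simps field_simps\<close>)
  next
    case 3
    show ?thesis by (rule that[of "b$3 / a$3"]) (use assms 3 in \<open>auto simp: vec3_simps field_simps\<close>)
  qed
qed

text \<open>The usual solution divides by \<open>cdot f f\<close>, which can vanish for a nonzero
  isotropic \<open>f\<close>; hence the cases by a nonzero coordinate.\<close>

lemma ccross_of_orthogonal:
  assumes "f \<noteq> 0" "cdot f v = 0"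
  obtains u where "v = ccross f u"
proof -
  from assms(1) consider "f$1 \<noteq> 0" | "f$2 \<noteq> 0" | "f$3 \<noteq> 0" by (auto simp: vec3_eq_iff)
  then show ?thesis
  proof cases
    case 1
    have "v = ccross f (vector [0, v$3 / f$1, - v$2 / f$1])"
      using assms 1 by (simp add: vec3_simps field_simps) algebra
    then show ?thesis by (rule that)
  next
    case 2
    have "v = ccross f (vector [- v$3 / f$2, 0, v$1 / f$2])"
      using assms 2 by (simp add: vec3_simps field_simps) algebra
    then show ?thesis by (rule that)
  next
    case 3
    have "v = ccross f (vector [v$2 / f$3, - v$1 / f$3, 0])"
      using assms 3 by (simp add: vec3_simps field_simps) algebra
    then show ?thesis by (rule that)
  qed
qed

text \<open>Two distinct lines of the projective plane meet in a single point, given by the cross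
  product of their covectors.\<close>

lemma scale_ccross_of_orthogonal:
  assumes "ccross f g \<noteq> 0" "cdot f v = 0" "cdot g v = 0"
  obtains s where "v = s *s ccross f g"
proof (rule parallel_of_ccross_eq_0[OF assms(1)])
  show "ccross (ccross f g) v = 0"
    using assms by (subst ccross_anticomm) (simp add: ccross_ccross cdot_commute)
qed

lemma exists_ccross_axis:
  assumes "(a::'a::field^3) \<noteq> 0"
  shows "\<exists>x. ccross a x \<noteq> 0"
proof -
  have "ccross a (axis 1 1) \<noteq> 0 \<or> ccross a (axis 2 1) \<noteq> 0"
    using assms by (auto simp: vec3_simps axis_def)
  then show ?thesis by blast
qed

text \<open>The span has rank at most two. The witness is the cross product of two independent
  members in rank two, of a nonzero member and any nonparallel vector in rank one, and arbitrary in
  rank zero.\<close>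

lemma exists_orthogonal:
  assumes "\<And>p q r. p \<in> T \<Longrightarrow> q \<in> T \<Longrightarrow> r \<in> T \<Longrightarrow> triple (\<gamma> p) (\<gamma> q) (\<gamma> r) = 0"
  shows "\<exists>f. f \<noteq> 0 \<and> (\<forall>p\<in>T. cdot f (\<gamma> p :: 'a::field^3) = 0)"
proof (cases "\<exists>p\<in>T. \<exists>q\<in>T. ccross (\<gamma> p) (\<gamma> q) \<noteq> 0")
  case True
  then show ?thesis using assms unfolding triple_def by blast
next
  case False
  show ?thesis
  proof (cases "\<exists>p\<in>T. \<gamma> p \<noteq> 0")
    case True
    then obtain p where p: "p \<in> T" "\<gamma> p \<noteq> 0" by blast
    obtain x where x: "ccross (\<gamma> p) x \<noteq> 0" using exists_ccross_axis[OF p(2)] by blast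
    have "cdot (ccross (\<gamma> p) x) (\<gamma> q) = 0" if "q \<in> T" for q
    proof -
      have "cdot (ccross (\<gamma> p) x) (\<gamma> q) = - cdot (ccross (\<gamma> p) (\<gamma> q)) x"
        by (simp add: vec3_simps algebra_simps)
      moreover have "ccross (\<gamma> p) (\<gamma> q) = 0" using False p(1) that by blast
      ultimately show ?thesis by simp
    qed
    then show ?thesis using x by blast
  next
    case False
    then show ?thesis by (intro exI[of _ "axis 1 1"]) (auto simp: axis_eq_0_iff)
  qed
qed

lemma ccross_eq_0_commute: "ccross a b = 0 \<longleftrightarrow> ccross b a = 0"
  by (metis ccross_anticomm neg_equal_0_iff_equal)

text \<open>The third coordinate of a cross product is the 2 by 2 determinant after projection from
  the point \<open>axis 3 1\<close>; collinear points are compared through it below.\<close>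

lemma triple_axis3 [simp]: "triple a b (axis 3 1) = ccross a b $ 3"
  by (simp add: vec3_simps axis_def)

section \<open>Linear dependence of families of at most four vectors\<close>

lemma lin_dep_fam_mono:
  assumes "lin_dep_fam \<gamma> S" "S \<subseteq> T" "finite T"
  shows "lin_dep_fam \<gamma> T"
proof -
  from assms(1) obtain c where c: "\<exists>p\<in>S. c p \<noteq> 0" "(\<Sum>p\<in>S. c p *s \<gamma> p) = 0"
    unfolding lin_dep_fam_def by blast
  define d where "d p = (if p \<in> S then c p else 0)" for p
  have "(\<Sum>p\<in>T. d p *s \<gamma> p) = (\<Sum>p\<in>S. d p *s \<gamma> p)"
    using assms by (intro sum.mono_neutral_right) (auto simp: d_def)
  also have "\<dots> = (\<Sum>p\<in>S. c p *s \<gamma> p)"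
    by (intro sum.cong) (auto simp: d_def)
  finally show ?thesis unfolding lin_dep_fam_def using c assms(2)
    by (intro exI[of _ d]) (auto simp: d_def)
qed

lemma lin_dep_fam_single: "lin_dep_fam \<gamma> {p} \<longleftrightarrow> \<gamma> p = 0"
  unfolding lin_dep_fam_def by (auto simp: vec.scale_eq_0_iff intro: exI[of _ "\<lambda>_. 1"])

lemma lin_dep_fam_pair:
  assumes "p \<noteq> q"
  shows "lin_dep_fam \<gamma> {p, q} \<longleftrightarrow> ccross (\<gamma> p) (\<gamma> q) = 0"
proof
  assume "lin_dep_fam \<gamma> {p, q}"
  then obtain c where c: "c p \<noteq> 0 \<or> c q \<noteq> 0" and s: "c p *s \<gamma> p + c q *s \<gamma> q = 0"
    using assms unfolding lin_dep_fam_def by auto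
  have "c p *s ccross (\<gamma> p) (\<gamma> q) = ccross (c p *s \<gamma> p + c q *s \<gamma> q) (\<gamma> q)"
    "c q *s ccross (\<gamma> p) (\<gamma> q) = ccross (\<gamma> p) (c p *s \<gamma> p + c q *s \<gamma> q)"
    by (simp_all only: ccross_linear ccross_scale) simp_all
  then show "ccross (\<gamma> p) (\<gamma> q) = 0" using c s by (auto simp: vec.scale_eq_0_iff)
next
  assume *: "ccross (\<gamma> p) (\<gamma> q) = 0"
  show "lin_dep_fam \<gamma> {p, q}"
  proof (cases "\<gamma> p = 0")
    case True
    then have "lin_dep_fam \<gamma> {p}" by (simp add: lin_dep_fam_single)
    then show ?thesis by (rule lin_dep_fam_mono) auto
  next
    case False
    then obtain s where "\<gamma> q = s *s \<gamma> p" using * by (rule parallel_of_ccross_eq_0)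
    then show ?thesis unfolding lin_dep_fam_def using assms
      by (intro exI[of _ "(\<lambda>_. - 1)(p := s)"]) auto
  qed
qed

lemma lin_dep_fam_triple:
  assumes "p \<noteq> q" "p \<noteq> r" "q \<noteq> r"
  shows "lin_dep_fam \<gamma> {p, q, r} \<longleftrightarrow> triple (\<gamma> p) (\<gamma> q) (\<gamma> r) = 0"
proof
  assume "lin_dep_fam \<gamma> {p, q, r}"
  then obtain c where c: "c p \<noteq> 0 \<or> c q \<noteq> 0 \<or> c r \<noteq> 0"
    and s: "c p *s \<gamma> p + c q *s \<gamma> q + c r *s \<gamma> r = 0"
    using assms unfolding lin_dep_fam_def by (auto simp: add.assoc)
  let ?s = "c p *s \<gamma> p + c q *s \<gamma> q + c r *s \<gamma> r"
  have "c p * triple (\<gamma> p) (\<gamma> q) (\<gamma> r) = triple ?s (\<gamma> q) (\<gamma> r)"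
    "c q * triple (\<gamma> p) (\<gamma> q) (\<gamma> r) = triple (\<gamma> p) ?s (\<gamma> r)"
    "c r * triple (\<gamma> p) (\<gamma> q) (\<gamma> r) = triple (\<gamma> p) (\<gamma> q) ?s"
    by (simp_all add: vec3_simps; algebra)+
  then show "triple (\<gamma> p) (\<gamma> q) (\<gamma> r) = 0" using c s by auto
next
  assume *: "triple (\<gamma> p) (\<gamma> q) (\<gamma> r) = 0"
  show "lin_dep_fam \<gamma> {p, q, r}"
  proof (cases "ccross (\<gamma> p) (\<gamma> q) = 0")
    case True
    then have "lin_dep_fam \<gamma> {p, q}" using assms by (simp add: lin_dep_fam_pair)
    then show ?thesis by (rule lin_dep_fam_mono) auto
  next
    case False
    then obtain k where k: "ccross (\<gamma> p) (\<gamma> q) $ k \<noteq> 0" by (auto simp: vec_eq_iff)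
    \<comment> \<open>A coordinate vector off the plane of \<open>\<gamma> p\<close> and
      \<open>\<gamma> q\<close>: with it \<open>cramer3\<close> becomes a relation in which
      \<open>\<gamma> r\<close> has a nonzero coefficient.\<close>
    define x :: "complex^3" where "x = axis k 1"
    have "triple (\<gamma> p) (\<gamma> q) x \<noteq> 0"
      using k exhaust_3[of k] by (auto simp: x_def triple_def cdot_def axis_def)
    moreover have "triple (\<gamma> q) (\<gamma> r) x *s \<gamma> p - triple (\<gamma> p) (\<gamma> r) x *s \<gamma> q
        + triple (\<gamma> p) (\<gamma> q) x *s \<gamma> r = 0"
      using * by (simp add: cramer3)
    ultimately show ?thesis unfolding lin_dep_fam_def using assms
      by (intro exI[of _ "(\<lambda>_. triple (\<gamma> p) (\<gamma> q) x)(p := triple (\<gamma> q) (\<gamma> r) x,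
            q := - triple (\<gamma> p) (\<gamma> r) x)"]) (auto simp: algebra_simps)
  qed
qed

lemma lin_dep_fam_quadruple:
  assumes "card S = 4"
  shows "lin_dep_fam \<gamma> S"
proof -
  obtain p q r s where S: "S = {p, q, r, s}" and
    d: "p \<noteq> q" "p \<noteq> r" "p \<noteq> s" "q \<noteq> r" "q \<noteq> s" "r \<noteq> s"
    using assms by (auto simp: card_Suc_eq numeral_eq_Suc)
  show ?thesis
  proof (cases "triple (\<gamma> p) (\<gamma> q) (\<gamma> r) = 0")
    case True
    then have "lin_dep_fam \<gamma> {p, q, r}" using d by (simp add: lin_dep_fam_triple)
    then show ?thesis by (rule lin_dep_fam_mono) (auto simp: S)
  next
    case False
    have "triple (\<gamma> q) (\<gamma> r) (\<gamma> s) *s \<gamma> p - triple (\<gamma> p) (\<gamma> r) (\<gamma> s) *s \<gamma> q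
        + triple (\<gamma> p) (\<gamma> q) (\<gamma> s) *s \<gamma> r - triple (\<gamma> p) (\<gamma> q) (\<gamma> r) *s \<gamma> s = 0"
      by (simp add: cramer3)
    then show ?thesis unfolding lin_dep_fam_def S using d False
      by (intro exI[of _ "(\<lambda>_. - triple (\<gamma> p) (\<gamma> q) (\<gamma> r))(p := triple (\<gamma> q) (\<gamma> r) (\<gamma> s),
            q := - triple (\<gamma> p) (\<gamma> r) (\<gamma> s), r := triple (\<gamma> p) (\<gamma> q) (\<gamma> s))"])
         (auto simp: algebra_simps)
  qed
qed

section \<open>Polynomial curves and Zariski closures\<close>

definition polynomial_map :: "(complex \<Rightarrow> complex) \<Rightarrow> bool" where
  "polynomial_map h \<longleftrightarrow> (\<exists>P. \<forall>t. h t = poly P t)"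

lemma polynomial_map_const: "polynomial_map (\<lambda>_. c)"
  unfolding polynomial_map_def by (intro exI[of _ "[:c:]"]) simp

lemma polynomial_map_id: "polynomial_map (\<lambda>t. t)"
  unfolding polynomial_map_def by (intro exI[of _ "[:0, 1:]"]) simp

lemma polynomial_map_add: "polynomial_map f \<Longrightarrow> polynomial_map g \<Longrightarrow> polynomial_map (\<lambda>t. f t + g t)"
  unfolding polynomial_map_def by (metis poly_add)

lemma polynomial_map_diff: "polynomial_map f \<Longrightarrow> polynomial_map g \<Longrightarrow> polynomial_map (\<lambda>t. f t - g t)"
  unfolding polynomial_map_def by (metis poly_diff)

lemma polynomial_map_mult: "polynomial_map f \<Longrightarrow> polynomial_map g \<Longrightarrow> polynomial_map (\<lambda>t. f t * g t)"
  unfolding polynomial_map_def by (metis poly_mult)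

lemma polynomial_map_if: "polynomial_map f \<Longrightarrow> polynomial_map g \<Longrightarrow> polynomial_map (\<lambda>t. if P then f t else g t)"
  by (cases P) simp_all

lemmas polynomial_map_intros = polynomial_map_const polynomial_map_id polynomial_map_add
  polynomial_map_diff polynomial_map_mult polynomial_map_if

lemma polynomial_map_finite_zeros:
  assumes "polynomial_map h" "h t0 \<noteq> 0"
  shows "finite {t. h t = 0}"
proof -
  obtain P where P: "\<And>t. h t = poly P t" using assms(1) unfolding polynomial_map_def by blast
  then have "P \<noteq> 0" using assms(2) by auto
  then show ?thesis by (simp add: P poly_roots_finite)
qed

definition polynomial_curve :: "nat \<Rightarrow> (complex \<Rightarrow> nat set \<Rightarrow> complex^3) \<Rightarrow> bool" where
  "polynomial_curve n g \<longleftrightarrow> (\<forall>t. g t \<in> ambient n) \<and> (\<forall>p k. polynomial_map (\<lambda>t. g t p $ k))"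

lemma polynomial_map_poly_fun:
  assumes "f \<in> poly_fun" "polynomial_curve n g"
  shows "polynomial_map (\<lambda>t. f (g t))"
  using assms by induction (auto simp: polynomial_curve_def intro: polynomial_map_const polynomial_map_add polynomial_map_mult)

lemma poly_fun_uminus: "f \<in> poly_fun \<Longrightarrow> (\<lambda>\<gamma>. - f \<gamma>) \<in> poly_fun"
  using poly_fun.pmult[OF poly_fun.pconst[of "-1"]] by simp

lemma poly_fun_diff: "f \<in> poly_fun \<Longrightarrow> g \<in> poly_fun \<Longrightarrow> (\<lambda>\<gamma>. f \<gamma> - g \<gamma>) \<in> poly_fun"
  using poly_fun.padd[OF _ poly_fun_uminus] by simp

lemmas poly_fun_intros = poly_fun.intros poly_fun_diff

lemma poly_fun_ccross: "(\<lambda>\<gamma>. ccross (\<gamma> p) (\<gamma> q) $ k) \<in> poly_fun"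
  using exhaust_3[of k] by (auto intro!: poly_fun_intros)

lemma poly_fun_triple: "(\<lambda>\<gamma>. triple (\<gamma> p) (\<gamma> q) (\<gamma> r)) \<in> poly_fun"
  by (auto simp: triple_def cdot_def intro!: poly_fun_intros)

lemma zclosure_eq:
  assumes "S \<subseteq> ambient n"
  shows "zclosure n S = {\<gamma> \<in> ambient n. \<forall>f\<in>poly_fun. (\<forall>\<delta>\<in>S. f \<delta> = 0) \<longrightarrow> f \<gamma> = 0}" (is "_ = ?C")
proof (intro equalityI subsetI)
  have "zclosed n ?C"
    unfolding zclosed_def by (rule exI[of _ "{f \<in> poly_fun. \<forall>\<delta>\<in>S. f \<delta> = 0}"]) auto
  moreover have "S \<subseteq> ?C" using assms by auto
  ultimately show "\<gamma> \<in> ?C" if "\<gamma> \<in> zclosure n S" for \<gamma>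
    using that unfolding zclosure_def by blast
  show "\<gamma> \<in> zclosure n S" if "\<gamma> \<in> ?C" for \<gamma>
    using that unfolding zclosure_def zclosed_def by auto
qed

lemma zclosed_zclosure:
  assumes "S \<subseteq> ambient n"
  shows "zclosed n (zclosure n S)"
  unfolding zclosure_eq[OF assms] zclosed_def
  by (rule exI[of _ "{f \<in> poly_fun. \<forall>\<delta>\<in>S. f \<delta> = 0}"]) auto

lemma zclosure_superset: "S \<subseteq> zclosure n S"
  unfolding zclosure_def by blast

lemma zclosure_minimal: "zclosed n X \<Longrightarrow> S \<subseteq> X \<Longrightarrow> zclosure n S \<subseteq> X"
  unfolding zclosure_def by blast

lemma zclosure_mono: "S \<subseteq> T \<Longrightarrow> zclosure n S \<subseteq> zclosure n T"
  unfolding zclosure_def by blast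

lemma zclosure_poly_fun_zero:
  assumes "S \<subseteq> ambient n" "f \<in> poly_fun" "\<And>\<delta>. \<delta> \<in> S \<Longrightarrow> f \<delta> = 0" "\<gamma> \<in> zclosure n S"
  shows "f \<gamma> = 0"
  using assms by (auto simp: zclosure_eq)

lemma zclosure_trans:
  assumes "S \<subseteq> zclosure n T" "T \<subseteq> ambient n"
  shows "zclosure n S \<subseteq> zclosure n T"
  using assms by (intro zclosure_minimal zclosed_zclosure)

text \<open>A polynomial that vanishes at infinitely many parameters vanishes along the whole curve.
  This replaces passing to a limit: the curve may leave \<open>S\<close> at exceptional parameters
  and still stays in the closure.\<close>

lemma polynomial_curve_in_zclosure:
  assumes "polynomial_curve n g" "infinite {t. g t \<in> S}" "S \<subseteq> ambient n"
  shows "g t \<in> zclosure n S"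
proof -
  have "f (g t) = 0" if f: "f \<in> poly_fun" "\<forall>\<delta>\<in>S. f \<delta> = 0" for f
  proof (rule ccontr)
    assume "f (g t) \<noteq> 0"
    then have "finite {t. f (g t) = 0}" using polynomial_map_finite_zeros polynomial_map_poly_fun[OF f(1) assms(1)] by blast
    moreover have "{t. g t \<in> S} \<subseteq> {t. f (g t) = 0}" using f(2) by auto
    ultimately show False using assms(2) finite_subset by blast
  qed
  then show ?thesis using assms by (auto simp: zclosure_eq polynomial_curve_def)
qed

lemma polynomial_curve_finite_bad:
  assumes "polynomial_curve n g" "finite F" "F \<subseteq> poly_fun" "\<And>f. f \<in> F \<Longrightarrow> \<exists>t. f (g t) \<noteq> 0"
  shows "finite {t. \<exists>f\<in>F. f (g t) = 0}"
proof -
  have "finite {t. f (g t) = 0}" if "f \<in> F" for f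
    using assms that polynomial_map_finite_zeros polynomial_map_poly_fun by blast
  then have "finite (\<Union>f\<in>F. {t. f (g t) = 0})" using assms(2) by blast
  moreover have "{t. \<exists>f\<in>F. f (g t) = 0} = (\<Union>f\<in>F. {t. f (g t) = 0})" by blast
  ultimately show ?thesis by simp
qed

section \<open>Generic points and irreducibility from connecting curves\<close>

definition curve_connected :: "nat \<Rightarrow> (nat set \<Rightarrow> complex^3) set \<Rightarrow> bool" where
  "curve_connected n I \<longleftrightarrow>
    (\<forall>x\<in>I. \<forall>y\<in>I. \<exists>g. polynomial_curve n g \<and> range g \<subseteq> I \<and> x \<in> range g \<and> y \<in> range g)"

lemma curve_connected_generic_curve:
  assumes "curve_connected n I" "finite F" "F \<subseteq> poly_fun" "x \<in> I" "y \<in> I" "\<And>f. f \<in> F \<Longrightarrow> f y \<noteq> 0"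
  shows "\<exists>g. polynomial_curve n g \<and> range g \<subseteq> I \<and> x \<in> range g \<and> y \<in> range g
    \<and> infinite {t. \<forall>f\<in>F. f (g t) \<noteq> 0}"
proof -
  obtain g where g: "polynomial_curve n g" "range g \<subseteq> I" "x \<in> range g" "y \<in> range g"
    using assms(1,4,5) unfolding curve_connected_def by blast
  have "finite {t. \<exists>f\<in>F. f (g t) = 0}"
    using g(4) assms by (intro polynomial_curve_finite_bad[OF g(1)]) auto
  then have "infinite (UNIV - {t. \<exists>f\<in>F. f (g t) = 0})"
    by (intro Diff_infinite_finite infinite_UNIV_char_0)
  moreover have "UNIV - {t. \<exists>f\<in>F. f (g t) = 0} = {t. \<forall>f\<in>F. f (g t) \<noteq> 0}" by auto
  ultimately show ?thesis using g by auto
qed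

text \<open>On a curve through a point good for \<open>F\<close> and a point good for
  \<open>f\<close>, each function has only finitely many zeros, so some parameter is good for all of
  them.\<close>

lemma curve_connected_common_nonzero:
  assumes "curve_connected n I" "I \<noteq> {}"
    and "finite F" "F \<subseteq> poly_fun" "\<And>f. f \<in> F \<Longrightarrow> \<exists>x\<in>I. f x \<noteq> 0"
  shows "\<exists>x\<in>I. \<forall>f\<in>F. f x \<noteq> 0"
  using assms(3-5)
proof (induction F rule: finite_induct)
  case empty
  then show ?case using assms(2) by auto
next
  case (insert f F)
  then obtain y where y: "y \<in> I" "\<forall>f\<in>F. f y \<noteq> 0" by auto
  obtain x where x: "x \<in> I" "f x \<noteq> 0" using insert.prems by auto
  obtain g where g: "polynomial_curve n g" "range g \<subseteq> I" "x \<in> range g" "infinite {t. \<forall>f\<in>F. f (g t) \<noteq> 0}"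
    using curve_connected_generic_curve[OF assms(1) insert.hyps(1) _ x(1) y(1)] y(2) insert.prems(1) by blast
  have "finite {t. f (g t) = 0}"
    using g(3) x(2) insert.prems(1) polynomial_map_finite_zeros[OF polynomial_map_poly_fun[OF _ g(1)], of f] by auto
  then have "infinite ({t. \<forall>f\<in>F. f (g t) \<noteq> 0} - {t. f (g t) = 0})"
    using g(4) by (rule Diff_infinite_finite)
  then obtain t where "t \<in> {t. \<forall>f\<in>F. f (g t) \<noteq> 0} - {t. f (g t) = 0}"
    using infinite_imp_nonempty by blast
  then show ?case using g(2) by auto
qed

lemma curve_connected_generic_dense:
  assumes "curve_connected n I" "I \<subseteq> ambient n"
    and "finite F" "F \<subseteq> poly_fun" "\<And>f. f \<in> F \<Longrightarrow> \<exists>x\<in>I. f x \<noteq> 0"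
  shows "I \<subseteq> zclosure n {x \<in> I. \<forall>f\<in>F. f x \<noteq> 0}"
proof
  fix x assume x: "x \<in> I"
  obtain y where y: "y \<in> I" "\<forall>f\<in>F. f y \<noteq> 0"
    using curve_connected_common_nonzero[OF assms(1) _ assms(3-5)] x by blast
  obtain g where g: "polynomial_curve n g" "range g \<subseteq> I" "x \<in> range g" "infinite {t. \<forall>f\<in>F. f (g t) \<noteq> 0}"
    using curve_connected_generic_curve[OF assms(1,3,4) x y(1)] y(2) by blast
  have "{t. \<forall>f\<in>F. f (g t) \<noteq> 0} = {t. g t \<in> {x \<in> I. \<forall>f\<in>F. f x \<noteq> 0}}"
    using g(2) by auto
  then have "g t \<in> zclosure n {x \<in> I. \<forall>f\<in>F. f x \<noteq> 0}" for t
    using g assms(2) by (intro polynomial_curve_in_zclosure) auto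
  then show "x \<in> zclosure n {x \<in> I. \<forall>f\<in>F. f x \<noteq> 0}" using g(3) by auto
qed

text \<open>If \<open>I\<close> lies in neither closed set, each has an equation that is nonzero
  somewhere on \<open>I\<close>; a point of \<open>I\<close> where both equations are nonzero lies
  outside the union.\<close>

lemma zirreducible_zclosure_curve_connected:
  assumes "curve_connected n I" "I \<subseteq> ambient n" "I \<noteq> {}"
  shows "zirreducible n (zclosure n I)"
  unfolding zirreducible_def
proof (intro conjI allI impI)
  show "zclosed n (zclosure n I)" using assms(2) by (rule zclosed_zclosure)
  show "zclosure n I \<noteq> {}" using assms(3) zclosure_superset by blast
  fix A B assume A: "zclosed n A" and B: "zclosed n B" and sub: "zclosure n I \<subseteq> A \<union> B"
  have generic: "\<exists>x\<in>I. \<forall>f\<in>F. f x \<noteq> 0"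
    if "finite F" "F \<subseteq> poly_fun" "\<And>f. f \<in> F \<Longrightarrow> \<exists>x\<in>I. f x \<noteq> 0" for F
    using that by (rule curve_connected_common_nonzero[OF assms(1,3)])
  have witness: "\<exists>f\<in>poly_fun. (\<forall>\<gamma>\<in>X. f \<gamma> = 0) \<and> (\<exists>x\<in>I. f x \<noteq> 0)"
    if "zclosed n X" "\<not> I \<subseteq> X" for X
    using that assms(2) unfolding zclosed_def by fastforce
  have "I \<subseteq> A \<or> I \<subseteq> B"
  proof (rule ccontr)
    assume "\<not> (I \<subseteq> A \<or> I \<subseteq> B)"
    then obtain a where a: "a \<in> poly_fun" "\<forall>\<gamma>\<in>A. a \<gamma> = 0" "\<exists>x\<in>I. a x \<noteq> 0"
      using witness[OF A] by auto
    from \<open>\<not> (I \<subseteq> A \<or> I \<subseteq> B)\<close>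
    obtain b where b: "b \<in> poly_fun" "\<forall>\<gamma>\<in>B. b \<gamma> = 0" "\<exists>x\<in>I. b x \<noteq> 0"
      using witness[OF B] by auto
    have "\<exists>x\<in>I. \<forall>f\<in>{a, b}. f x \<noteq> 0"
      by (rule generic) (use a b in auto)
    then obtain x where "x \<in> I" "a x \<noteq> 0" "b x \<noteq> 0" by auto
    then show False using a b sub zclosure_superset by blast
  qed
  then show "zclosure n I \<subseteq> A \<or> zclosure n I \<subseteq> B" using A B zclosure_minimal by blast
qed

section \<open>Parametrized strata\<close>

lemma pair_in_pts: "i \<in> {1..n} \<Longrightarrow> j \<in> {1..n} \<Longrightarrow> i \<noteq> j \<Longrightarrow> {i, j} \<in> pts n"
  by (auto simp: pts_def)

lemma ptsE:
  assumes "p \<in> pts n"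
  obtains i j where "i \<in> {1..n}" "j \<in> {1..n}" "i < j" "p = {i, j}" "Min p = i" "Max p = j"
proof -
  from assms obtain a b where ab: "p = {a, b}" "a \<noteq> b" "a \<in> {1..n}" "b \<in> {1..n}"
    by (auto simp: pts_def card_2_iff)
  show ?thesis
  proof (cases "a < b")
    case True
    then show ?thesis using ab that[of a b] by simp
  next
    case False
    then show ?thesis using ab that[of b a] by (simp add: insert_commute)
  qed
qed

lemma finite_pts: "finite (pts n)"
  by (rule finite_subset[of _ "Pow {1..n}"]) (auto simp: pts_def)

lemma mem_lineE:
  assumes "p \<in> line n i"
  obtains j where "i \<in> {1..n}" "j \<in> {1..n}" "i \<noteq> j" "p = {i, j}"
proof -
  from assms have "p \<in> pts n" "i \<in> p" by (auto simp: line_def)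
  then obtain a b where "a \<in> {1..n}" "b \<in> {1..n}" "a < b" "p = {a, b}" "i = a \<or> i = b"
    by (auto elim: ptsE)
  then show ?thesis using that[of a] that[of b] by (auto simp: insert_commute[of b a])
qed

text \<open>\<open>Min\<close> and \<open>Max\<close> orient the unordered pair, since the cross
  product is antisymmetric. Inside a class the two lines coincide and their intersection is
  undetermined, so the point is any point of that line, given by the free vector
  \<open>u p\<close>.\<close>

definition param ::
  "nat \<Rightarrow> nat rel \<Rightarrow> (nat \<Rightarrow> complex^3) \<Rightarrow> (nat set \<Rightarrow> complex^3) \<Rightarrow> (nat set \<Rightarrow> complex) \<Rightarrow> nat set \<Rightarrow> complex^3"
  where "param n R f u c p =
    (if p \<in> pts n
     then if (Min p, Max p) \<in> R then ccross (f (Min p)) (u p) else c p *s ccross (f (Min p)) (f (Max p))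
     else 0)"

definition const_on_classes :: "nat rel \<Rightarrow> (nat \<Rightarrow> complex^3) \<Rightarrow> bool" where
  "const_on_classes R f \<longleftrightarrow> (\<forall>i j. (i, j) \<in> R \<longrightarrow> f i = f j)"

text \<open>Zero and proportional covectors are allowed, which makes the parameters a linear space;
  genericity is recovered by density.\<close>

definition stratum :: "nat \<Rightarrow> nat rel \<Rightarrow> (nat set \<Rightarrow> complex^3) set" where
  "stratum n R = {param n R f u c | f u c. const_on_classes R f}"

lemma param_same:
  assumes "const_on_classes R f" "sym R" "i \<in> {1..n}" "j \<in> {1..n}" "i \<noteq> j" "(i, j) \<in> R"
  shows "param n R f u c {i, j} = ccross (f i) (u {i, j})"
proof -
  have "(j, i) \<in> R" "f i = f j" using assms by (auto simp: const_on_classes_def dest: symD)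
  then show ?thesis using assms pair_in_pts[of i n j] by (auto simp: param_def min_def max_def)
qed

lemma param_diff:
  assumes "sym R" "i \<in> {1..n}" "j \<in> {1..n}" "i \<noteq> j" "(i, j) \<notin> R"
  shows "param n R f u c {i, j} = (if i < j then c {i, j} else - c {i, j}) *s ccross (f i) (f j)"
proof -
  have "(j, i) \<notin> R" using assms by (auto dest: symD)
  then show ?thesis using assms pair_in_pts[of i n j] ccross_anticomm[of "f i" "f j"]
    by (auto simp: param_def min_def max_def)
qed

lemma stratum_subset_ambient: "stratum n R \<subseteq> ambient n"
  by (auto simp: stratum_def ambient_def param_def)

lemma stratum_nonempty: "stratum n R \<noteq> {}"
proof -
  have "param n R (\<lambda>_. 0) (\<lambda>_. 0) (\<lambda>_. 0) \<in> stratum n R"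
    by (auto simp: stratum_def const_on_classes_def)
  then show ?thesis by blast
qed

lemma stratumI:
  assumes "\<gamma> \<in> ambient n" "const_on_classes R f"
    and same: "\<And>i j. i \<in> {1..n} \<Longrightarrow> j \<in> {1..n} \<Longrightarrow> i < j \<Longrightarrow> (i, j) \<in> R \<Longrightarrow>
      \<exists>u. \<gamma> {i, j} = ccross (f i) u"
    and diff: "\<And>i j. i \<in> {1..n} \<Longrightarrow> j \<in> {1..n} \<Longrightarrow> i < j \<Longrightarrow> (i, j) \<notin> R \<Longrightarrow>
      \<exists>c. \<gamma> {i, j} = c *s ccross (f i) (f j)"
  shows "\<gamma> \<in> stratum n R"
proof -
  define u where "u p = (SOME u. \<gamma> p = ccross (f (Min p)) u)" for p
  define c where "c p = (SOME c. \<gamma> p = c *s ccross (f (Min p)) (f (Max p)))" for p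
  have "\<gamma> p = param n R f u c p" for p
  proof (cases "p \<in> pts n")
    case True
    then obtain i j where ij: "i \<in> {1..n}" "j \<in> {1..n}" "i < j" "p = {i, j}" "Min p = i" "Max p = j"
      by (rule ptsE)
    show ?thesis
    proof (cases "(i, j) \<in> R")
      case R: True
      then have "\<exists>u. \<gamma> p = ccross (f (Min p)) u" using same ij by simp
      then have "\<gamma> p = ccross (f (Min p)) (u p)" unfolding u_def by (rule someI_ex)
      then show ?thesis using True R ij by (simp add: param_def)
    next
      case R: False
      then have "\<exists>c. \<gamma> p = c *s ccross (f (Min p)) (f (Max p))" using diff ij by simp
      then have "\<gamma> p = c p *s ccross (f (Min p)) (f (Max p))" unfolding c_def by (rule someI_ex)
      then show ?thesis using True R ij by (simp add: param_def)
    qed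
  next
    case False
    then show ?thesis using assms(1) by (simp add: param_def ambient_def)
  qed
  then have "\<gamma> = param n R f u c" by (rule ext)
  then show ?thesis using assms(2) by (auto simp: stratum_def)
qed

lemma param_eq_ccross_of_line:
  assumes "const_on_classes R f" "sym R" "p \<in> line n i"
  shows "\<exists>w. param n R f u c p = ccross (f i) w"
proof -
  obtain j where j: "i \<in> {1..n}" "j \<in> {1..n}" "i \<noteq> j" "p = {i, j}"
    using assms(3) by (rule mem_lineE)
  show ?thesis
  proof (cases "(i, j) \<in> R")
    case True
    then show ?thesis using param_same[OF assms(1,2) j(1,2,3)] j(4) by blast
  next
    case False
    have "param n R f u c p = ccross (f i) ((if i < j then c {i, j} else - c {i, j}) *s f j)"
      using param_diff[OF assms(2) j(1,2,3) False] j(4) by (simp add: ccross_scale)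
    then show ?thesis by blast
  qed
qed

lemma stratum_line_triple_eq_0:
  assumes "\<gamma> \<in> stratum n R" "sym R" "{p, q, r} \<subseteq> \<Union>(line n ` (R `` {i}))"
  shows "triple (\<gamma> p) (\<gamma> q) (\<gamma> r) = 0"
proof -
  from assms(1) obtain f u c where \<gamma>: "\<gamma> = param n R f u c" and f: "const_on_classes R f"
    by (auto simp: stratum_def)
  have "\<exists>w. \<gamma> p = ccross (f i) w" if "p \<in> \<Union>(line n ` (R `` {i}))" for p
  proof -
    from that obtain j where j: "(i, j) \<in> R" "p \<in> line n j" by auto
    have "f i = f j" using f j(1) unfolding const_on_classes_def by metis
    then show ?thesis using param_eq_ccross_of_line[OF f assms(2) j(2)] unfolding \<gamma> by simp
  qed
  then obtain w where w: "\<gamma> p = ccross (f i) (w p)" "\<gamma> q = ccross (f i) (w q)" "\<gamma> r = ccross (f i) (w r)"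
    using assms(3) by (metis insert_subset)
  show ?thesis
  proof (cases "f i = 0")
    case True
    then show ?thesis using w by simp
  next
    case False
    then show ?thesis unfolding w by (rule triple_eq_0_of_orthogonal) simp_all
  qed
qed

text \<open>The parameters are interpolated, not the points. Constancy on classes is a linear
  condition and survives on the segment, while each point becomes a polynomial in \<open>t\<close>
  of degree at most three.\<close>

lemma stratum_curve_connected: "curve_connected n (stratum n R)"
  unfolding curve_connected_def
proof (intro ballI)
  fix x y assume "x \<in> stratum n R" "y \<in> stratum n R"
  then obtain f u c f' u' c' where
    x: "x = param n R f u c" "const_on_classes R f" and y: "y = param n R f' u' c'" "const_on_classes R f'"
    by (auto simp: stratum_def)
  define F where "F t i = f i + t *s (f' i - f i)" for t i
  define U where "U t p = u p + t *s (u' p - u p)" for t p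
  define C where "C t p = c p + t * (c' p - c p)" for t p
  define g where "g t = param n R (F t) (U t) (C t)" for t
  have "polynomial_map (\<lambda>t. g t p $ k)" for p k
  proof -
    have "polynomial_map (\<lambda>t. g t p $ 1)" "polynomial_map (\<lambda>t. g t p $ 2)" "polynomial_map (\<lambda>t. g t p $ 3)"
      unfolding g_def param_def F_def U_def C_def if_distrib[where f = "\<lambda>x. x $ _"]
        vector_add_component vector_minus_component vector_smult_component ccross_nth
      by (intro polynomial_map_intros)+
    then show ?thesis using exhaust_3[of k] by auto
  qed
  moreover have const: "const_on_classes R (F t)" for t
    using x(2) y(2) unfolding const_on_classes_def F_def by metis
  then have "g t \<in> stratum n R" for t by (auto simp: stratum_def g_def)
  ultimately have "polynomial_curve n g" "range g \<subseteq> stratum n R"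
    using stratum_subset_ambient[of n R] by (auto simp: polynomial_curve_def)
  moreover have "F 0 = f" "U 0 = u" "C 0 = c" "F 1 = f'" "U 1 = u'" "C 1 = c'"
    by (auto simp: F_def U_def C_def)
  then have "g 0 = x" "g 1 = y" by (auto simp: g_def x y)
  ultimately show "\<exists>g. polynomial_curve n g \<and> range g \<subseteq> stratum n R \<and> x \<in> range g \<and> y \<in> range g"
    by (metis rangeI)
qed

section \<open>The circuit variety as a union of strata\<close>

lemma V_circ_L_eq:
  "V_circ_L n = {\<gamma> \<in> ambient n. \<forall>i\<in>{1..n}. \<forall>p\<in>line n i. \<forall>q\<in>line n i. \<forall>r\<in>line n i.
     triple (\<gamma> p) (\<gamma> q) (\<gamma> r) = 0}" (is "_ = ?V")
proof (intro equalityI subsetI)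
  fix \<gamma> assume \<gamma>: "\<gamma> \<in> V_circ_L n"
  have "triple (\<gamma> p) (\<gamma> q) (\<gamma> r) = 0"
    if i: "i \<in> {1..n}" and l: "p \<in> line n i" "q \<in> line n i" "r \<in> line n i" for i p q r
  proof (cases "p \<noteq> q \<and> p \<noteq> r \<and> q \<noteq> r")
    case True
    then have "circuit_L n {p, q, r}"
      using i l by (auto simp: circuit_L_def lines_def line_def)
    then have "dep_of n (circuit_L n) {p, q, r}"
      unfolding dep_of_def by (metis circuit_L_def order_refl)
    then have "lin_dep_fam \<gamma> {p, q, r}" using \<gamma> by (simp add: V_circ_L_def circuit_variety_def)
    then show ?thesis using True by (simp add: lin_dep_fam_triple)
  qed auto
  then show "\<gamma> \<in> ?V" using \<gamma> by (auto simp: V_circ_L_def circuit_variety_def)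
next
  fix \<gamma> assume \<gamma>: "\<gamma> \<in> ?V"
  have "lin_dep_fam \<gamma> S" if "dep_of n (circuit_L n) S" for S
  proof -
    from that obtain C where C: "C \<subseteq> S" "circuit_L n C" and S: "S \<subseteq> pts n" by (auto simp: dep_of_def)
    have "lin_dep_fam \<gamma> C"
    \<comment> \<open>Four vectors are always dependent in dimension three, so only the collinearity
      conditions on each line remain.\<close>
    proof (cases "card C = 4")
      case True
      then show ?thesis by (rule lin_dep_fam_quadruple)
    next
      case False
      then obtain i where i: "i \<in> {1..n}" "C \<subseteq> line n i" "card C = 3"
        using C(2) by (auto simp: circuit_L_def lines_def)
      then obtain p q r where "C = {p, q, r}" "p \<noteq> q" "p \<noteq> r" "q \<noteq> r"
        by (auto simp: card_3_iff)
      then show ?thesis using \<gamma> i by (auto simp: lin_dep_fam_triple)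
    qed
    then show ?thesis using C(1) finite_subset[OF S finite_pts] by (rule lin_dep_fam_mono)
  qed
  then show "\<gamma> \<in> V_circ_L n" using \<gamma> by (auto simp: V_circ_L_def circuit_variety_def)
qed

lemma zclosed_V_circ_L: "zclosed n (V_circ_L n)"
  unfolding zclosed_def V_circ_L_eq
  by (rule exI[of _ "{\<lambda>\<gamma>. triple (\<gamma> p) (\<gamma> q) (\<gamma> r) | i p q r.
        i \<in> {1..n} \<and> p \<in> line n i \<and> q \<in> line n i \<and> r \<in> line n i}"])
     (auto simp: poly_fun_triple; blast)

lemma stratum_subset_V_circ_L:
  assumes "equiv {1..n} R"
  shows "stratum n R \<subseteq> V_circ_L n"
proof
  fix \<gamma> assume \<gamma>: "\<gamma> \<in> stratum n R"
  have symR: "sym R" using assms by (simp add: equiv_def)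
  have "triple (\<gamma> p) (\<gamma> q) (\<gamma> r) = 0"
    if "i \<in> {1..n}" "p \<in> line n i" "q \<in> line n i" "r \<in> line n i" for i p q r
    using equiv_class_self[OF assms that(1)] that(2-)
    by (intro stratum_line_triple_eq_0[OF \<gamma> symR, of _ _ _ i]) auto
  then show "\<gamma> \<in> V_circ_L n"
    using stratum_subset_ambient \<gamma> unfolding V_circ_L_eq by blast
qed

lemma V_circ_L_subset_stratum:
  assumes "\<gamma> \<in> V_circ_L n"
  shows "\<exists>R. equiv {1..n} R \<and> \<gamma> \<in> stratum n R"
proof -
  have "\<exists>f. f \<noteq> 0 \<and> (\<forall>p\<in>line n i. cdot f (\<gamma> p) = 0)" if "i \<in> {1..n}" for i
    using assms that by (intro exists_orthogonal) (simp add: V_circ_L_eq)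
  then obtain f where f: "\<And>i. i \<in> {1..n} \<Longrightarrow> f i \<noteq> 0"
    "\<And>i p. i \<in> {1..n} \<Longrightarrow> p \<in> line n i \<Longrightarrow> cdot (f i) (\<gamma> p) = 0"
    by metis
  \<comment> \<open>Proportionality is expressed by a vanishing cross product; it is transitive here
    only because no covector is zero.\<close>
  define R where "R = {(i, j). i \<in> {1..n} \<and> j \<in> {1..n} \<and> ccross (f i) (f j) = 0}"
  have R: "equiv {1..n} R"
  proof (rule equivI)
    show "R \<subseteq> {1..n} \<times> {1..n}" "refl_on {1..n} R"
      by (auto simp: R_def refl_on_def)
    show "sym R"
      by (rule symI) (auto simp: R_def ccross_eq_0_commute)
    show "trans R"
    proof (rule transI)
      fix i j k assume ij: "(i, j) \<in> R" and jk: "(j, k) \<in> R"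
      then have m: "i \<in> {1..n}" "j \<in> {1..n}" "ccross (f i) (f j) = 0" "ccross (f j) (f k) = 0"
        by (auto simp: R_def)
      obtain s where "f j = s *s f i" using f(1)[OF m(1)] m(3) by (rule parallel_of_ccross_eq_0)
      moreover obtain t where "f k = t *s f j" using f(1)[OF m(2)] m(4) by (rule parallel_of_ccross_eq_0)
      ultimately show "(i, k) \<in> R" using ij jk by (auto simp: R_def ccross_scale)
    qed
  qed
  \<comment> \<open>The choice depends on the class alone, so replacing each covector by that of its
    representative turns proportionality within a class into the equality required by
    \<open>const_on_classes\<close>.\<close>
  define rep where "rep i = (SOME j. j \<in> R `` {i})" for i
  have rep: "(i, rep i) \<in> R" if "i \<in> {1..n}" for i
  proof -
    have "i \<in> R `` {i}" using R that by (rule equiv_class_self)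
    then have "rep i \<in> R `` {i}" unfolding rep_def by (rule someI)
    then show ?thesis by simp
  qed
  define g where "g i = f (rep i)" for i
  have g: "g i \<noteq> 0" "\<And>p. p \<in> line n i \<Longrightarrow> cdot (g i) (\<gamma> p) = 0" if i: "i \<in> {1..n}" for i
  proof -
    have r: "rep i \<in> {1..n}" "ccross (f i) (f (rep i)) = 0" using rep[OF i] by (auto simp: R_def)
    show "g i \<noteq> 0" using r f(1) by (simp add: g_def)
    obtain s where "f (rep i) = s *s f i" using f(1)[OF i] r(2) by (rule parallel_of_ccross_eq_0)
    then show "cdot (g i) (\<gamma> p) = 0" if "p \<in> line n i" for p
      using f(2)[OF i that] by (simp add: g_def cdot_scale)
  qed
  have g_diff: "ccross (g i) (g j) \<noteq> 0" if ij: "i \<in> {1..n}" "j \<in> {1..n}" "(i, j) \<notin> R" for i j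
  proof
    assume "ccross (g i) (g j) = 0"
    then have "(rep i, rep j) \<in> R" using rep[OF ij(1)] rep[OF ij(2)] by (auto simp: R_def g_def)
    then have "(i, j) \<in> R"
      using rep[OF ij(1)] rep[OF ij(2)] R by (meson equiv_def symD transD)
    then show False using ij by blast
  qed
  have "\<gamma> \<in> stratum n R"
  proof (rule stratumI)
    show "\<gamma> \<in> ambient n" using assms by (simp add: V_circ_L_eq)
    show "const_on_classes R g"
      using equiv_class_eq[OF R] by (simp add: const_on_classes_def g_def rep_def)
  next
    fix i j assume ij: "i \<in> {1..n}" "j \<in> {1..n}" "i < j"
    then have l: "{i, j} \<in> line n i" "{i, j} \<in> line n j" using pair_in_pts[of i n j] by (auto simp: line_def)
    show "\<exists>u. \<gamma> {i, j} = ccross (g i) u"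
      using g[OF ij(1)] l by (metis ccross_of_orthogonal)
    show "\<exists>c. \<gamma> {i, j} = c *s ccross (g i) (g j)" if "(i, j) \<notin> R"
      using g[OF ij(1)] g[OF ij(2)] l g_diff[OF ij(1,2) that] by (metis scale_ccross_of_orthogonal)
  qed
  then show ?thesis using R by blast
qed

section \<open>Splitting small classes\<close>

definition split_class :: "nat rel \<Rightarrow> nat set \<Rightarrow> nat rel" where
  "split_class R K = {(i, j) \<in> R. i \<notin> K \<or> i = j}"

lemma equiv_split_class:
  assumes "equiv {1..n} R" "i \<in> {1..n}"
  shows "equiv {1..n} (split_class R (R `` {i}))"
proof (rule equivI)
  have R: "R \<subseteq> {1..n} \<times> {1..n}" "refl_on {1..n} R" and symR: "sym R" and transR: "trans R"
    using assms(1) by (auto simp: equiv_def)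
  show "split_class R (R `` {i}) \<subseteq> {1..n} \<times> {1..n}" "refl_on {1..n} (split_class R (R `` {i}))"
    using R by (auto simp: split_class_def refl_on_def)
  show "sym (split_class R (R `` {i}))"
    unfolding split_class_def by (rule symI) (use symR transR in \<open>blast dest: symD transD\<close>)
  show "trans (split_class R (R `` {i}))"
    unfolding split_class_def by (rule transI) (use transR in \<open>blast dest: transD\<close>)
qed

text \<open>The cross product of \<open>f + t v j\<close> and \<open>f + t v k\<close> is
  \<open>t\<close> times \<open>ccross f (v k - v j) + t ccross (v j) (v k)\<close>. The free scalar
  of a split pair absorbs the factor \<open>t\<close>, and what is left tends to the prescribed
  point.\<close>

lemma in_zclosure_stratum_split_class:
  assumes R: "equiv {1..n} R" and i: "i \<in> {1..n}"
    and f: "const_on_classes R f" and \<gamma>: "\<gamma> = param n R f u c"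
    and v: "\<And>j k. (i, j) \<in> R \<Longrightarrow> (i, k) \<in> R \<Longrightarrow> j < k \<Longrightarrow>
      \<exists>b. \<gamma> {j, k} = b *s ccross (f i) (v k - v j)"
  shows "\<gamma> \<in> zclosure n (stratum n (split_class R (R `` {i})))"
proof -
  let ?K = "R `` {i}"
  let ?R' = "split_class R ?K"
  have symR: "sym R" and transR: "trans R" and subR: "R \<subseteq> {1..n} \<times> {1..n}"
    using R by (auto simp: equiv_def)
  define w where "w j = (if j \<in> ?K then v j else 0)" for j
  define F where "F t j = f j + t *s w j" for t j
  define b where "b p = (SOME b. \<gamma> p = b *s ccross (f i) (v (Max p) - v (Min p)))" for p
  have b: "\<gamma> {j, k} = b {j, k} *s ccross (f i) (v k - v j)"
    if "j \<in> ?K" "k \<in> ?K" "j < k" for j k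
  proof -
    have "Min {j, k} = j" "Max {j, k} = k" using that(3) by auto
    then have "\<exists>b. \<gamma> {j, k} = b *s ccross (f i) (v (Max {j, k}) - v (Min {j, k}))"
      using v that by simp
    then have "\<gamma> {j, k} = b {j, k} *s ccross (f i) (v (Max {j, k}) - v (Min {j, k}))"
      unfolding b_def by (rule someI_ex)
    then show ?thesis using that(3) by simp
  qed
  \<comment> \<open>The factor \<open>t\<close> is already cancelled on the split class, so the
    curve is polynomial and defined at 0. For \<open>t \<noteq> 0\<close> its points there have the
    scalar \<open>b p / t\<close> in the split stratum; points inside other classes stay
    fixed.\<close>
  define g where "g t p =
    (if p \<in> pts n
     then if (Min p, Max p) \<in> R
       then if Min p \<in> ?K then \<gamma> p + t *s (b p *s ccross (v (Min p)) (v (Max p))) else \<gamma> p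
       else c p *s ccross (F t (Min p)) (F t (Max p))
     else 0)" for t p
  have "polynomial_map (\<lambda>t. g t p $ k)" for p k
  proof -
    have "polynomial_map (\<lambda>t. g t p $ 1)" "polynomial_map (\<lambda>t. g t p $ 2)" "polynomial_map (\<lambda>t. g t p $ 3)"
      unfolding g_def F_def if_distrib[where f = "\<lambda>x. x $ _"] vector_add_component vector_smult_component
        ccross_nth
      by (intro polynomial_map_intros)+
    then show ?thesis using exhaust_3[of k] by auto
  qed
  moreover have amb: "g t \<in> ambient n" for t by (auto simp: ambient_def g_def)
  ultimately have "polynomial_curve n g" by (auto simp: polynomial_curve_def)
  moreover have "g t \<in> stratum n ?R'" if t: "t \<noteq> 0" for t
  proof (rule stratumI[OF amb])
    show "const_on_classes ?R' (F t)"
      unfolding const_on_classes_def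
    proof (intro allI impI)
      fix j k assume "(j, k) \<in> ?R'"
      then have jk: "(j, k) \<in> R" "j \<notin> ?K \<or> j = k" by (auto simp: split_class_def)
      then have "f j = f k" "j \<in> ?K \<longleftrightarrow> k \<in> ?K"
        using f symR transR by (auto simp: const_on_classes_def dest: symD transD)
      then show "F t j = F t k" using jk(2) by (auto simp: F_def w_def)
    qed
  next
    fix j k assume jk: "j \<in> {1..n}" "k \<in> {1..n}" "j < k" and "(j, k) \<in> ?R'"
    then have R': "(j, k) \<in> R" "j \<notin> ?K" by (auto simp: split_class_def)
    then have "g t {j, k} = \<gamma> {j, k}" using jk pair_in_pts[of j n k] by (auto simp: g_def)
    also have "\<dots> = ccross (f j) (u {j, k})" using param_same[OF f symR _ _ _ R'(1)] jk \<gamma> by simp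
    also have "f j = F t j" using R' by (simp add: F_def w_def)
    finally show "\<exists>u. g t {j, k} = ccross (F t j) u" by (rule exI)
  next
    fix j k assume jk: "j \<in> {1..n}" "k \<in> {1..n}" "j < k" and nR': "(j, k) \<notin> ?R'"
    have p: "{j, k} \<in> pts n" "Min {j, k} = j" "Max {j, k} = k" using jk pair_in_pts[of j n k] by auto
    show "\<exists>c. g t {j, k} = c *s ccross (F t j) (F t k)"
    proof (cases "(j, k) \<in> R")
      case True
      then have K: "j \<in> ?K" "k \<in> ?K" using nR' transR by (auto simp: split_class_def dest: transD)
      have fjk: "f j = f i" "f k = f i"
        using f K unfolding const_on_classes_def by (metis Image_singleton_iff)+
      have "g t {j, k} = \<gamma> {j, k} + t *s (b {j, k} *s ccross (v j) (v k))"
        using p True K by (simp add: g_def)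
      also have "\<dots> = b {j, k} *s (ccross (f i) (v k - v j) + t *s ccross (v j) (v k))"
        unfolding b[OF K jk(3)] by (simp add: vec3_simps algebra_simps)
      also have "ccross (f i) (v k - v j) + t *s ccross (v j) (v k)
          = (1 / t) *s ccross (f i + t *s v j) (f i + t *s v k)"
        using t by (simp add: vec3_simps field_simps)
      also have "f i + t *s v j = F t j" using K(1) by (simp add: F_def w_def fjk)
      also have "f i + t *s v k = F t k" using K(2) by (simp add: F_def w_def fjk)
      finally have "g t {j, k} = (b {j, k} / t) *s ccross (F t j) (F t k)" by simp
      then show ?thesis by blast
    next
      case False
      then show ?thesis using p by (auto simp: g_def)
    qed
  qed
  then have "UNIV - {0} \<subseteq> {t. g t \<in> stratum n ?R'}" by auto
  then have "infinite {t. g t \<in> stratum n ?R'}"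
    by (rule infinite_super) (simp add: Diff_infinite_finite infinite_UNIV_char_0)
  ultimately have "g 0 \<in> zclosure n (stratum n ?R')"
    using stratum_subset_ambient by (rule polynomial_curve_in_zclosure)
  moreover have "g 0 = \<gamma>"
    by (rule ext) (simp add: g_def \<gamma> param_def F_def)
  ultimately show ?thesis by simp
qed

definition adm_rel :: "nat \<Rightarrow> nat rel \<Rightarrow> bool" where
  "adm_rel n R \<longleftrightarrow> equiv {1..n} R \<and> (\<forall>i\<in>{1..n}. card (R `` {i}) \<notin> {2, 3, n - 1})"

text \<open>Only one index lies outside the class, so every pair of distinct indices contains a
  member of it and every point lies on the common line.\<close>

lemma stratum_subset_stratum_full:
  assumes R: "equiv {1..n} R" and i: "i \<in> {1..n}" and card: "card (R `` {i}) = n - 1"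
  shows "stratum n R \<subseteq> stratum n ({1..n} \<times> {1..n})"
proof
  fix \<gamma> assume "\<gamma> \<in> stratum n R"
  then obtain f u c where \<gamma>: "\<gamma> = param n R f u c" and f: "const_on_classes R f"
    by (auto simp: stratum_def)
  have symR: "sym R" and sub: "R `` {i} \<subseteq> {1..n}" using R by (auto simp: equiv_def)
  have "card ({1..n} - R `` {i}) = n - (n - 1)"
    using sub card by (subst card_Diff_subset) (auto intro: finite_subset)
  \<comment> \<open>The truncated subtraction is harmless because the index \<open>i\<close> forces
    \<open>n \<ge> 1\<close>.\<close>
  also have "\<dots> = 1" using i by auto
  finally obtain m where m: "{1..n} - R `` {i} = {m}" by (auto simp: card_1_singleton_iff)
  have "\<exists>w. \<gamma> p = ccross (f i) w" if "p \<in> line n j" "(i, j) \<in> R" for p j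
    using param_eq_ccross_of_line[OF f symR that(1)] f that(2)
    unfolding \<gamma> const_on_classes_def by metis
  moreover have "(i, j) \<in> R \<or> (i, k) \<in> R" if "j \<in> {1..n}" "k \<in> {1..n}" "j < k" for j k
  proof (rule ccontr)
    assume "\<not> ((i, j) \<in> R \<or> (i, k) \<in> R)"
    then have "j \<in> {1..n} - R `` {i}" "k \<in> {1..n} - R `` {i}" using that by auto
    then have "j = m" "k = m" unfolding m by auto
    then show False using that by simp
  qed
  moreover have "{j, k} \<in> line n j \<and> {j, k} \<in> line n k" if "j \<in> {1..n}" "k \<in> {1..n}" "j < k" for j k
    using that pair_in_pts[of j n k] by (auto simp: line_def)
  ultimately have *: "\<exists>w. \<gamma> {j, k} = ccross (f i) w" if "j \<in> {1..n}" "k \<in> {1..n}" "j < k" for j k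
    using that by meson
  show "\<gamma> \<in> stratum n ({1..n} \<times> {1..n})"
  proof (rule stratumI[where f = "\<lambda>_. f i"])
    show "\<gamma> \<in> ambient n" using \<open>\<gamma> \<in> stratum n R\<close> stratum_subset_ambient by blast
  qed (use * in \<open>auto simp: const_on_classes_def\<close>)
qed

lemma stratum_subset_zclosure_split_pair:
  assumes R: "equiv {1..n} R" and i: "i \<in> {1..n}" and card: "card (R `` {i}) = 2"
  shows "stratum n R \<subseteq> zclosure n (stratum n (split_class R (R `` {i})))"
proof
  fix \<gamma> assume "\<gamma> \<in> stratum n R"
  then obtain f u c where \<gamma>: "\<gamma> = param n R f u c" and f: "const_on_classes R f"
    by (auto simp: stratum_def)
  obtain a b where K: "R `` {i} = {a, b}" "a \<noteq> b" using card by (auto simp: card_2_iff)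
  have symR: "sym R" and transR: "trans R" and sub: "R \<subseteq> {1..n} \<times> {1..n}"
    using R by (auto simp: equiv_def)
  have ia: "(i, a) \<in> R" and ib: "(i, b) \<in> R" using K by auto
  then have ab: "a \<in> {1..n}" "b \<in> {1..n}" "(a, b) \<in> R" using sub symR transR by (auto dest: symD transD)
  have "f a = f i" using f ia by (simp add: const_on_classes_def)
  then have g: "\<gamma> {a, b} = ccross (f i) (u {a, b})"
    using param_same[OF f symR ab(1,2) K(2) ab(3)] \<gamma> by simp
  show "\<gamma> \<in> zclosure n (stratum n (split_class R (R `` {i})))"
  \<comment> \<open>A class of two lines carries only one internal point, so moving the line
    \<open>b\<close> alone, in the direction of that point's own parameter, produces it.\<close>
  proof (rule in_zclosure_stratum_split_class[OF R i f \<gamma>, where v = "(\<lambda>_. 0)(b := u {a, b})"])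
    fix j k assume "(i, j) \<in> R" "(i, k) \<in> R" "j < k"
    then have "j \<in> {a, b}" "k \<in> {a, b}" "j \<noteq> k" unfolding K(1)[symmetric] by auto
    then have "j = a \<and> k = b \<or> j = b \<and> k = a" by auto
    then show "\<exists>s. \<gamma> {j, k} = s *s ccross (f i) (((\<lambda>_. 0)(b := u {a, b})) k - ((\<lambda>_. 0)(b := u {a, b})) j)"
    proof
      assume "j = a \<and> k = b"
      then show ?thesis using g K(2) by (intro exI[of _ 1]) simp
    next
      assume "j = b \<and> k = a"
      then show ?thesis using g K(2) by (intro exI[of _ "-1"]) (simp add: insert_commute vec3_simps)
    qed
  qed
qed

text \<open>Three collinear points are vectors in a plane and satisfy a linear relation. If its
  coefficients are nonzero, they rescale the vectors to the sides of a triangle, whose vertices give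
  the directions \<open>v\<close>. The coefficients are 2 by 2 determinants, so this works on a
  dense subset, which suffices.\<close>

lemma stratum_subset_zclosure_split_triple:
  assumes R: "equiv {1..n} R" and i: "i \<in> {1..n}" and card: "card (R `` {i}) = 3"
  shows "stratum n R \<subseteq> zclosure n (stratum n (split_class R (R `` {i})))" (is "_ \<subseteq> ?Z")
proof -
  obtain a b c where K: "R `` {i} = {a, b, c}" and ne: "a \<noteq> b" "a \<noteq> c" "b \<noteq> c"
    using card by (auto simp: card_3_iff)
  have symR: "sym R" and transR: "trans R" and sub: "R \<subseteq> {1..n} \<times> {1..n}"
    using R by (auto simp: equiv_def)
  have iR: "(i, a) \<in> R" "(i, b) \<in> R" "(i, c) \<in> R" using K by auto
  then have n: "a \<in> {1..n}" "b \<in> {1..n}" "c \<in> {1..n}" using sub by auto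
  have R3: "(a, b) \<in> R" "(a, c) \<in> R" "(b, c) \<in> R" using iR symR transR by (meson symD transD)+
  have val: "param n R f u d {a, b} = ccross (f i) (u {a, b})"
    "param n R f u d {a, c} = ccross (f i) (u {a, c})"
    "param n R f u d {b, c} = ccross (f i) (u {b, c})" if f: "const_on_classes R f" for f u d
  proof -
    have "f a = f i" "f b = f i" using f iR unfolding const_on_classes_def by metis+
    then show "param n R f u d {a, b} = ccross (f i) (u {a, b})"
      "param n R f u d {a, c} = ccross (f i) (u {a, c})"
      "param n R f u d {b, c} = ccross (f i) (u {b, c})"
      using param_same[OF f symR] n ne R3 by simp_all
  qed
  define h where "h p q = (\<lambda>\<gamma>::nat set \<Rightarrow> complex^3. ccross (\<gamma> p) (\<gamma> q) $ 3)" for p q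
  define F where "F = {h {b, c} {a, b}, h {a, c} {b, c}, h {a, c} {a, b}}"
  let ?U = "{x \<in> stratum n R. \<forall>f\<in>F. f x \<noteq> 0}"
  have "stratum n R \<subseteq> zclosure n ?U"
  proof (rule curve_connected_generic_dense[OF stratum_curve_connected stratum_subset_ambient])
    have "h p q \<in> poly_fun" for p q unfolding h_def by (rule poly_fun_ccross)
    then show "finite F" "F \<subseteq> poly_fun" by (auto simp: F_def)
    \<comment> \<open>The default value is the one at \<open>{b, c}\<close> and completes three
      pairwise independent directions; the covector \<open>axis 3 1\<close> makes their independence
      visible in the third coordinate.\<close>
    define u :: "nat set \<Rightarrow> complex^3" where
      "u = (\<lambda>_. axis 1 1 + axis 2 1)({a, b} := axis 1 1, {a, c} := axis 2 1)"
    define \<delta> where "\<delta> = param n R (\<lambda>_. axis 3 1) u (\<lambda>_. 0)"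
    have const: "const_on_classes R (\<lambda>_. axis 3 1)" by (simp add: const_on_classes_def)
    have u: "u {a, b} = axis 1 1" "u {a, c} = axis 2 1" "u {b, c} = axis 1 1 + axis 2 1"
      using ne by (auto simp: u_def doubleton_eq_iff)
    have "\<delta> \<in> stratum n R" using const by (auto simp: stratum_def \<delta>_def)
    moreover have "f \<delta> \<noteq> 0" if "f \<in> F" for f
      using that val[OF const, of u "\<lambda>_. 0"] u unfolding \<delta>_def F_def h_def
      by (auto simp: axis_def)
    ultimately show "\<exists>x\<in>stratum n R. f x \<noteq> 0" if "f \<in> F" for f using that by blast
  qed
  moreover have "?U \<subseteq> ?Z"
  proof
    fix \<gamma> assume "\<gamma> \<in> ?U"
    then obtain f u d where \<gamma>: "\<gamma> = param n R f u d" and f: "const_on_classes R f"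
      and nz: "ccross (\<gamma> {b, c}) (\<gamma> {a, b}) $ 3 \<noteq> 0" "ccross (\<gamma> {a, c}) (\<gamma> {b, c}) $ 3 \<noteq> 0"
        "ccross (\<gamma> {a, c}) (\<gamma> {a, b}) $ 3 \<noteq> 0"
      by (auto simp: stratum_def F_def h_def)
    note val' = val[OF f, of u d, folded \<gamma>]
    \<comment> \<open>The coefficients of \<open>cramer3\<close> with auxiliary vector
      \<open>axis 3 1\<close>, signed so that the relation exhibits the third point as a difference
      of the other two.\<close>
    define \<alpha> \<beta> \<epsilon> where "\<alpha> = ccross (\<gamma> {a, c}) (\<gamma> {b, c}) $ 3"
      and "\<beta> = - ccross (\<gamma> {b, c}) (\<gamma> {a, b}) $ 3" and "\<epsilon> = - ccross (\<gamma> {a, c}) (\<gamma> {a, b}) $ 3"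
    have nz': "\<alpha> \<noteq> 0" "\<beta> \<noteq> 0" "\<epsilon> \<noteq> 0" using nz by (auto simp: \<alpha>_def \<beta>_def \<epsilon>_def)
    have "f i \<noteq> 0" using nz(1) val' by auto
    then have "triple (\<gamma> {a, b}) (\<gamma> {a, c}) (\<gamma> {b, c}) = 0"
      unfolding val' by (rule triple_eq_0_of_orthogonal) simp_all
    then have rel: "\<beta> *s \<gamma> {a, c} - \<alpha> *s \<gamma> {a, b} = \<epsilon> *s \<gamma> {b, c}"
      using cramer3[of "\<gamma> {a, c}" "\<gamma> {b, c}" "axis 3 1" "\<gamma> {a, b}"]
      by (simp add: \<alpha>_def \<beta>_def \<epsilon>_def vec3_simps algebra_simps)
    define v where "v = (\<lambda>_. 0)(b := \<alpha> *s u {a, b}, c := \<beta> *s u {a, c})"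
    define P where "P j k \<longleftrightarrow> (\<exists>s. \<gamma> {j, k} = s *s ccross (f i) (v k - v j))" for j k
    have flip: "P k j" if jk: "P j k" for j k
    proof -
      from jk obtain s where "\<gamma> {j, k} = s *s ccross (f i) (v k - v j)" by (auto simp: P_def)
      then have "\<gamma> {k, j} = (- s) *s ccross (f i) (v j - v k)"
        by (simp add: insert_commute vec3_simps algebra_simps)
      then show ?thesis unfolding P_def by blast
    qed
    have "P a b" unfolding P_def
      using nz' ne val' by (intro exI[of _ "1 / \<alpha>"]) (simp add: v_def ccross_scale)
    moreover have "P a c" unfolding P_def
      using nz' ne val' by (intro exI[of _ "1 / \<beta>"]) (simp add: v_def ccross_scale)
    moreover have "P b c"
    proof -
      have "ccross (f i) (v c - v b) = \<epsilon> *s \<gamma> {b, c}"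
        using ne rel val' by (simp add: v_def ccross_scale ccross_linear)
      then show ?thesis unfolding P_def using nz' by (intro exI[of _ "1 / \<epsilon>"]) simp
    qed
    ultimately have "P j k" if "(i, j) \<in> R" "(i, k) \<in> R" "j < k" for j k
    proof -
      have "j \<in> {a, b, c}" "k \<in> {a, b, c}" unfolding K[symmetric] using that by auto
      then show ?thesis using \<open>P a b\<close> \<open>P a c\<close> \<open>P b c\<close> flip that(3) by auto
    qed
    then show "\<gamma> \<in> ?Z" unfolding P_def by (intro in_zclosure_stratum_split_class[OF R i f \<gamma>])
  qed
  then have "zclosure n ?U \<subseteq> ?Z" by (rule zclosure_trans[OF _ stratum_subset_ambient])
  ultimately show ?thesis by blast
qed

text \<open>Splitting a class removes pairs from \<open>R\<close>, which drives the induction. The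
  full relation is larger than \<open>R\<close>, so it cannot be fed to the induction hypothesis,
  but it is admissible at once because its only class has \<open>n \<ge> 4\<close> elements.\<close>

lemma stratum_subset_zclosure_adm_rel:
  assumes "n \<ge> 4" "equiv {1..n} R"
  shows "\<exists>R'. adm_rel n R' \<and> stratum n R \<subseteq> zclosure n (stratum n R')"
  using assms(2)
proof (induction "card R" arbitrary: R rule: less_induct)
  case less
  have sub: "R \<subseteq> {1..n} \<times> {1..n}" using less.prems by (simp add: equiv_def)
  then have fin: "finite R" by (rule finite_subset) simp
  consider "adm_rel n R" | i where "i \<in> {1..n}" "card (R `` {i}) = n - 1"
    | i where "i \<in> {1..n}" "card (R `` {i}) = 2 \<or> card (R `` {i}) = 3"
    using less.prems unfolding adm_rel_def by blast
  then show ?case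
  proof cases
    case 1
    then show ?thesis using zclosure_superset by blast
  next
    case (2 i)
    let ?R' = "{1..n} \<times> {1..n}"
    have "?R' `` {j} = {1..n}" if "j \<in> {1..n}" for j using that by auto
    moreover have "equiv {1..n} ?R'" by (auto intro!: equivI simp: refl_on_def sym_def trans_def)
    ultimately have "adm_rel n ?R'" using assms(1) by (auto simp: adm_rel_def)
    then show ?thesis using stratum_subset_stratum_full[OF less.prems 2] zclosure_superset by blast
  next
    case (3 i)
    let ?R' = "split_class R (R `` {i})"
    have "?R' \<subset> R"
    proof -
      have "i \<in> R `` {i}" using less.prems 3(1) by (rule equiv_class_self)
      moreover have "R `` {i} \<noteq> {i}" using 3(2) by auto
      ultimately obtain j where "(i, j) \<in> R" "j \<noteq> i" "i \<in> R `` {i}" by blast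
      then show ?thesis by (auto simp: split_class_def)
    qed
    then have "card ?R' < card R" using fin by (simp add: psubset_card_mono)
    then obtain R'' where R'': "adm_rel n R''" "stratum n ?R' \<subseteq> zclosure n (stratum n R'')"
      using less.hyps equiv_split_class[OF less.prems 3(1)] by blast
    have "stratum n R \<subseteq> zclosure n (stratum n ?R')"
      using 3 stratum_subset_zclosure_split_pair[OF less.prems] stratum_subset_zclosure_split_triple[OF less.prems]
      by blast
    also have "\<dots> \<subseteq> zclosure n (stratum n R'')" using R''(2) stratum_subset_ambient by (rule zclosure_trans)
    finally show ?thesis using R''(1) by blast
  qed
qed

section \<open>Irredundancy\<close>

text \<open>A third class gives a triangle of three intersection points. With only two classes, each
  has a second member, and so each line carries a free point besides the common one. This is where
  the exclusion of \<open>n - 1\<close> is used.\<close>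

lemma exists_independent_lines:
  assumes "adm_rel n R" "n \<ge> 4" and i: "i \<in> {1..n}" and j: "j \<in> {1..n}" and ij: "(i, j) \<notin> R"
  shows "\<exists>p\<in>line n i \<union> line n j. \<exists>q\<in>line n i \<union> line n j. \<exists>r\<in>line n i \<union> line n j.
    \<exists>\<gamma>\<in>stratum n R. triple (\<gamma> p) (\<gamma> q) (\<gamma> r) \<noteq> 0"
proof -
  have R: "equiv {1..n} R" and adm_rel: "card (R `` {i}) \<notin> {2, 3, n - 1}" "card (R `` {j}) \<notin> {2, 3, n - 1}"
    using assms by (auto simp: adm_rel_def)
  have symR: "sym R" and transR: "trans R" and sub: "R \<subseteq> {1..n} \<times> {1..n}" and refl: "\<And>l. l \<in> {1..n} \<Longrightarrow> (l, l) \<in> R"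
    using R by (auto simp: equiv_def refl_on_def)
  have ne: "i \<noteq> j" using ij refl i by auto
  have ji: "(j, i) \<notin> R" using ij symR by (auto dest: symD)
  define f :: "nat \<Rightarrow> complex^3" where
    "f l = (if (i, l) \<in> R then axis 1 1 else if (j, l) \<in> R then axis 2 1 else axis 3 1)" for l
  have f: "const_on_classes R f"
    unfolding const_on_classes_def
  proof (intro allI impI)
    fix k l assume "(k, l) \<in> R"
    then have "(i, k) \<in> R \<longleftrightarrow> (i, l) \<in> R" "(j, k) \<in> R \<longleftrightarrow> (j, l) \<in> R"
      using symR transR by (meson symD transD)+
    then show "f k = f l" by (simp add: f_def)
  qed
  have fi: "f i = axis 1 1" and fj: "f j = axis 2 1" using refl i j ij by (auto simp: f_def)
  define \<gamma> where "\<gamma> = param n R f (\<lambda>_. axis 3 1) (\<lambda>_. 1)"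
  have \<gamma>: "\<gamma> \<in> stratum n R" using f by (auto simp: stratum_def \<gamma>_def)
  note same = param_same[OF f symR, of _ n _ "\<lambda>_. axis 3 1" "\<lambda>_. 1", folded \<gamma>_def]
  note diff = param_diff[OF symR, of _ n _ f "\<lambda>_. axis 3 1" "\<lambda>_. 1", folded \<gamma>_def]
  have line: "{k, l} \<in> line n k" if "k \<in> {1..n}" "l \<in> {1..n}" "k \<noteq> l" for k l
    using that pair_in_pts[of k n l] by (auto simp: line_def)
  show ?thesis
  proof (cases "\<exists>k\<in>{1..n}. (i, k) \<notin> R \<and> (j, k) \<notin> R")
    case True
    then obtain k where k: "k \<in> {1..n}" "(i, k) \<notin> R" "(j, k) \<notin> R" by blast
    then have fk: "f k = axis 3 1" by (simp add: f_def)
    have ne': "i \<noteq> k" "j \<noteq> k" using k refl i j by auto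
    have "triple (\<gamma> {i, j}) (\<gamma> {i, k}) (\<gamma> {j, k}) \<noteq> 0"
      unfolding diff[OF i j ne ij] diff[OF i k(1) ne'(1) k(2)] diff[OF j k(1) ne'(2) k(3)] fi fj fk
      by (auto simp: triple_def cdot_def axis_def)
    then show ?thesis using \<gamma> line i j k(1) ne ne' by blast
  next
    case False
    \<comment> \<open>With two classes only, an \<open>i\<close> alone in its class would leave
      \<open>n - 1\<close> indices to the class of \<open>j\<close>.\<close>
    have other: "\<exists>k. (i, k) \<in> R \<and> k \<noteq> i"
      if "card (R `` {j}) \<noteq> n - 1" "i \<in> {1..n}" "(i, j) \<notin> R" "(j, i) \<notin> R"
        "\<forall>k\<in>{1..n}. (i, k) \<in> R \<or> (j, k) \<in> R" for i j
    proof (rule ccontr)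
      assume none: "\<nexists>k. (i, k) \<in> R \<and> k \<noteq> i"
      have "R `` {j} = {1..n} - {i}"
      proof (intro equalityI subsetI)
        fix k assume "k \<in> R `` {j}"
        then show "k \<in> {1..n} - {i}" using sub that(4) by auto
      next
        fix k assume "k \<in> {1..n} - {i}"
        then show "k \<in> R `` {j}" using that(5) none by auto
      qed
      then show False using that(1,2) by simp
    qed
    obtain k where k: "(i, k) \<in> R" "k \<noteq> i" using other[of j i] adm_rel i ij ji False by auto
    obtain l where l: "(j, l) \<in> R" "l \<noteq> j" using other[of i j] adm_rel j ij ji False by auto
    have kl: "k \<in> {1..n}" "l \<in> {1..n}" using sub k l by auto
    have "triple (\<gamma> {i, j}) (\<gamma> {i, k}) (\<gamma> {j, l}) \<noteq> 0"
      unfolding diff[OF i j ne ij] same[OF i kl(1) k(2)[symmetric] k(1)]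
        same[OF j kl(2) l(2)[symmetric] l(1)] fi fj
      by (auto simp: triple_def cdot_def axis_def)
    then show ?thesis using \<gamma> line i j kl ne k l by blast
  qed
qed

text \<open>A projection of the six intersection points of four lines is a quadrilateral set: its three
  pairs of opposite vertices are in involution. This condition survives when the four lines
  degenerate to one line, where the six points would otherwise be arbitrary.\<close>

lemma ccross_quadrilateral:
  "ccross (ccross a b) (ccross b d) $ 3 * ccross (ccross a c) (ccross b c) $ 3
      * ccross (ccross a d) (ccross c d) $ 3
    + ccross (ccross c d) (ccross a c) $ 3 * ccross (ccross b d) (ccross a d) $ 3
      * ccross (ccross b c) (ccross a b) $ 3 = 0"
proof -
  \<comment> \<open>Each bracket joins two intersection points on a common line and so is a multiple
    of its covector. Both products then contain the same three determinants and the same three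
    coordinates, and the three minus signs make them cancel.\<close>
  have "ccross (ccross a b) (ccross b d) = triple a b d *s b"
    "ccross (ccross a c) (ccross b c) = triple a b c *s c"
    "ccross (ccross a d) (ccross c d) = triple a c d *s d"
    "ccross (ccross c d) (ccross a c) = - triple a c d *s c"
    "ccross (ccross b d) (ccross a d) = - triple a b d *s d"
    "ccross (ccross b c) (ccross a b) = - triple a b c *s b"
    by (simp_all add: vec3_simps; intro conjI; algebra)+
  then show ?thesis by simp
qed

text \<open>Each of the six points occurs exactly once in both products, so the vanishing is
  insensitive to rescaling any of them, including the signs from orienting pairs.\<close>

definition quadrilateral :: "nat \<Rightarrow> nat \<Rightarrow> nat \<Rightarrow> nat \<Rightarrow> (nat set \<Rightarrow> complex^3) \<Rightarrow> complex" where
  "quadrilateral a b c d \<gamma> =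
     ccross (\<gamma> {a, b}) (\<gamma> {b, d}) $ 3 * ccross (\<gamma> {a, c}) (\<gamma> {b, c}) $ 3 * ccross (\<gamma> {a, d}) (\<gamma> {c, d}) $ 3
   + ccross (\<gamma> {c, d}) (\<gamma> {a, c}) $ 3 * ccross (\<gamma> {b, d}) (\<gamma> {a, d}) $ 3 * ccross (\<gamma> {b, c}) (\<gamma> {a, b}) $ 3"

lemma quadrilateral_poly_fun: "quadrilateral a b c d \<in> poly_fun"
  unfolding quadrilateral_def[abs_def] by (intro poly_fun.padd poly_fun.pmult poly_fun_ccross)

lemma quadrilateral_stratum_eq_0:
  assumes "\<gamma> \<in> stratum n R" "sym R" "{a, b, c, d} \<subseteq> {1..n}" "distinct [a, b, c, d]"
    and "(a, b) \<notin> R" "(a, c) \<notin> R" "(a, d) \<notin> R" "(b, c) \<notin> R" "(b, d) \<notin> R" "(c, d) \<notin> R"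
  shows "quadrilateral a b c d \<gamma> = 0"
proof -
  obtain f u s where \<gamma>: "\<gamma> = param n R f u s"
    using assms(1) by (auto simp: stratum_def)
  have *: "\<exists>s. \<gamma> {i, j} = s *s ccross (f i) (f j)"
    if "i \<in> {1..n}" "j \<in> {1..n}" "i \<noteq> j" "(i, j) \<notin> R" for i j
    using param_diff[OF assms(2) that, of f u s] unfolding \<gamma> by blast
  have mem: "a \<in> {1..n}" "b \<in> {1..n}" "c \<in> {1..n}" "d \<in> {1..n}"
    and ne: "a \<noteq> b" "a \<noteq> c" "a \<noteq> d" "b \<noteq> c" "b \<noteq> d" "c \<noteq> d"
    using assms(3,4) by auto
  obtain s1 s2 s3 s4 s5 s6 where s: "\<gamma> {a, b} = s1 *s ccross (f a) (f b)"
    "\<gamma> {a, c} = s2 *s ccross (f a) (f c)" "\<gamma> {a, d} = s3 *s ccross (f a) (f d)"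
    "\<gamma> {b, c} = s4 *s ccross (f b) (f c)" "\<gamma> {b, d} = s5 *s ccross (f b) (f d)"
    "\<gamma> {c, d} = s6 *s ccross (f c) (f d)"
    using *[OF mem(1,2) ne(1) assms(5)] *[OF mem(1,3) ne(2) assms(6)] *[OF mem(1,4) ne(3) assms(7)]
      *[OF mem(2,3) ne(4) assms(8)] *[OF mem(2,4) ne(5) assms(9)] *[OF mem(3,4) ne(6) assms(10)] by metis
  have sc: "ccross (x *s v) (y *s w) $ 3 = x * y * ccross v w $ 3" for x y and v w :: "complex^3"
    by (simp add: algebra_simps)
  have "quadrilateral a b c d \<gamma> = s1 * s2 * s3 * s4 * s5 * s6 *
     (ccross (ccross (f a) (f b)) (ccross (f b) (f d)) $ 3 * ccross (ccross (f a) (f c)) (ccross (f b) (f c)) $ 3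
      * ccross (ccross (f a) (f d)) (ccross (f c) (f d)) $ 3
    + ccross (ccross (f c) (f d)) (ccross (f a) (f c)) $ 3 * ccross (ccross (f b) (f d)) (ccross (f a) (f d)) $ 3
      * ccross (ccross (f b) (f c)) (ccross (f a) (f b)) $ 3)"
    unfolding quadrilateral_def s sc by algebra
  then show ?thesis unfolding ccross_quadrilateral by simp
qed

text \<open>Polynomials vanishing on the stratum of \<open>R'\<close> must vanish on that of
  \<open>R\<close>. Determinants give \<open>R' \<subseteq> R\<close>. Points forced to coincide by
  \<open>R'\<close> but free for \<open>R\<close> show that \<open>R'\<close> breaks a class of
  \<open>R\<close> completely if at all, and such a class, having at least four members, is excluded
  by the quadrilateral relation.\<close>

lemma adm_rel_eqI:
  assumes adm_rel: "adm_rel n R" and R': "equiv {1..n} R'" and n: "n \<ge> 4"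
    and sub: "stratum n R \<subseteq> zclosure n (stratum n R')"
  shows "R = R'"
proof (rule ccontr)
  assume "R \<noteq> R'"
  have R: "equiv {1..n} R" using adm_rel by (simp add: adm_rel_def)
  have symR: "sym R" and transR: "trans R" and subR: "R \<subseteq> {1..n} \<times> {1..n}"
    using R by (auto simp: equiv_def)
  have symR': "sym R'" and subR': "R' \<subseteq> {1..n} \<times> {1..n}" using R' by (auto simp: equiv_def)
  have vanish: "h \<gamma> = 0" if "h \<in> poly_fun" "\<And>\<delta>. \<delta> \<in> stratum n R' \<Longrightarrow> h \<delta> = 0" "\<gamma> \<in> stratum n R" for h \<gamma>
    using zclosure_poly_fun_zero[OF stratum_subset_ambient that(1,2)] sub that(3) by blast
  have "R' \<subseteq> R"
  proof (rule subrelI, rule ccontr)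
    fix i j assume R'ij: "(i, j) \<in> R'" and nij: "(i, j) \<notin> R"
    have "i \<in> {1..n}" "j \<in> {1..n}" using R'ij subR' by auto
    then obtain p q r \<gamma> where p: "p \<in> line n i \<union> line n j" "q \<in> line n i \<union> line n j"
      "r \<in> line n i \<union> line n j" and \<gamma>: "\<gamma> \<in> stratum n R" "triple (\<gamma> p) (\<gamma> q) (\<gamma> r) \<noteq> 0"
      using exists_independent_lines[OF adm_rel n _ _ nij] by blast
    have "(i, i) \<in> R'" using R' R'ij by (auto simp: equiv_def refl_on_def)
    then have p': "{p, q, r} \<subseteq> \<Union>(line n ` (R' `` {i}))" using p R'ij by auto
    have "triple (\<gamma> p) (\<gamma> q) (\<gamma> r) = 0"
      by (rule vanish[OF poly_fun_triple _ \<gamma>(1)]) (rule stratum_line_triple_eq_0[OF _ symR', where i = i], use p' in auto)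
    then show False using \<gamma>(2) by blast
  qed
  then obtain a b where ab: "(a, b) \<in> R" "(a, b) \<notin> R'" using \<open>R \<noteq> R'\<close> by auto
  have a: "a \<in> {1..n}" "b \<in> {1..n}" using ab subR by auto
  let ?K = "R `` {a}"
  have aK: "a \<in> ?K" using R a(1) by (rule equiv_class_self)
  have KR: "(i, j) \<in> R" if "i \<in> ?K" "j \<in> ?K" for i j using that symR transR by (auto dest: symD transD)
  have K: "?K \<subseteq> {1..n}" using subR by auto
  then have "finite ?K" by (rule finite_subset) simp
  \<comment> \<open>All classes get the same line, since only points inside the class
    \<open>?K\<close> are tested; these are quarter turns of the freely chosen \<open>u\<close>,
    projected to the first two coordinates.\<close>
  have const: "const_on_classes R (\<lambda>_. axis 3 1)" by (simp add: const_on_classes_def)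
  define \<gamma> where "\<gamma> u = param n R (\<lambda>_. axis 3 1) u (\<lambda>_. 0)" for u
  have \<gamma>: "\<gamma> u \<in> stratum n R" for u using const by (auto simp: stratum_def \<gamma>_def)
  have val: "\<gamma> u {i, j} = ccross (axis 3 1) (u {i, j})" if "i \<in> ?K" "j \<in> ?K" "i \<noteq> j" for i j u
    unfolding \<gamma>_def using param_same[OF const symR _ _ that(3) KR[OF that(1,2)]] that K by blast
  have pairwise: "(i, i') \<notin> R'" if i: "i \<in> ?K" "i' \<in> ?K" "i \<noteq> i'" for i i'
  proof
    assume R'ii: "(i, i') \<in> R'"
    \<comment> \<open>The class \<open>?K\<close> contains \<open>a\<close> and \<open>b\<close>,
      which \<open>R'\<close> separates. Lines \<open>i\<close> and \<open>i'\<close>, merged by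
      \<open>R'\<close>, then meet the line \<open>j\<close> in the same point.\<close>
    have "\<exists>j\<in>?K. (i, j) \<notin> R'"
    proof (rule ccontr)
      assume "\<not> (\<exists>j\<in>?K. (i, j) \<notin> R')"
      then have "(i, a) \<in> R'" "(i, b) \<in> R'" using aK ab(1) by auto
      then show False using ab(2) R' by (meson equiv_def symD transD)
    qed
    then obtain j where j: "j \<in> ?K" "(i, j) \<notin> R'" by blast
    have i'j: "(i', j) \<notin> R'" using R'ii j(2) R' by (meson equiv_def transD)
    have mem: "i \<in> {1..n}" "i' \<in> {1..n}" "j \<in> {1..n}" using i j K by auto
    have "(i, i) \<in> R'" using R' mem(1) by (simp add: equiv_def refl_on_def)
    then have ne: "i \<noteq> j" "i' \<noteq> j" using j(2) R'ii by auto
    have "ccross (\<delta> {i, j}) (\<delta> {i', j}) $ 3 = 0" if "\<delta> \<in> stratum n R'" for \<delta>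
    proof -
      obtain f u s where \<delta>: "\<delta> = param n R' f u s" "const_on_classes R' f"
        using \<open>\<delta> \<in> stratum n R'\<close> by (auto simp: stratum_def)
      have "f i' = f i" using \<delta>(2) R'ii unfolding const_on_classes_def by metis
      then show ?thesis
        unfolding \<delta>(1) param_diff[OF symR' mem(1,3) ne(1) j(2)] param_diff[OF symR' mem(2,3) ne(2) i'j]
        by (simp add: ccross_scale del: ccross_nth)
    qed
    then have *: "ccross (\<gamma> u {i, j}) (\<gamma> u {i', j}) $ 3 = 0" for u
      using vanish[OF poly_fun_ccross _ \<gamma>] by blast
    have "{i, j} \<noteq> {i', j}" using i(3) ne by (auto simp: doubleton_eq_iff)
    then show False
      using *[of "(\<lambda>_. axis 1 1)({i', j} := axis 2 1)"] val[OF i(1) j(1) ne(1)] val[OF i(2) j(1) ne(2)]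
      by (simp add: axis_def)
  qed
  have "card ?K \<ge> 4"
  proof -
    have "card {a, b} \<le> card ?K" using aK ab(1) \<open>finite ?K\<close> by (intro card_mono) auto
    moreover have "a \<noteq> b" using ab R' a by (auto simp: equiv_def refl_on_def)
    moreover have "card ?K \<noteq> 2" "card ?K \<noteq> 3" using adm_rel a(1) by (auto simp: adm_rel_def)
    ultimately show ?thesis by simp
  qed
  then obtain T where "T \<subseteq> ?K" "card T = 4" using obtain_subset_with_card_n by metis
  moreover from this obtain i j k l where "T = {i, j, k, l}" and d: "distinct [i, j, k, l]"
    by (auto simp: card_Suc_eq numeral_eq_Suc)
  ultimately have in_K: "i \<in> ?K" "j \<in> ?K" "k \<in> ?K" "l \<in> ?K" by auto
  have ne: "i \<noteq> j" "i \<noteq> k" "i \<noteq> l" "j \<noteq> k" "j \<noteq> l" "k \<noteq> l" using d by auto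
  have "quadrilateral i j k l \<delta> = 0" if "\<delta> \<in> stratum n R'" for \<delta>
    using quadrilateral_stratum_eq_0[OF that symR' _ d] pairwise in_K ne K by blast
  then have "quadrilateral i j k l (\<gamma> u) = 0" for u
    by (rule vanish[OF quadrilateral_poly_fun _ \<gamma>])
  \<comment> \<open>The two directions differ in all three brackets of the first product, while the
    second product contains a bracket of equal vectors and vanishes.\<close>
  moreover define u :: "nat set \<Rightarrow> complex^3" where
    "u = (\<lambda>_. axis 1 1)({i, l} := axis 2 1, {j, l} := axis 2 1, {j, k} := axis 2 1)"
  have "u {i, j} = axis 1 1" "u {i, k} = axis 1 1" "u {k, l} = axis 1 1"
    "u {i, l} = axis 2 1" "u {j, l} = axis 2 1" "u {j, k} = axis 2 1"
    using ne by (auto simp: u_def doubleton_eq_iff)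
  then have "quadrilateral i j k l (\<gamma> u) \<noteq> 0"
    using in_K ne unfolding quadrilateral_def by (simp add: val axis_def del: Image_singleton_iff)
  ultimately show False by blast
qed

section \<open>Generic independence of points\<close>

lemma path_colouring:
  assumes "a \<noteq> b" "b \<noteq> d" "a \<noteq> d" "e \<noteq> f" "b \<noteq> e" "b \<noteq> f"
  shows "\<exists>\<phi>::'v \<Rightarrow> 3. \<phi> ` {a, b} = {1, 2} \<and> \<phi> ` {b, d} = {2, 3} \<and> \<phi> ` {e, f} = {1, 3}"
proof -
  \<comment> \<open>The colours of \<open>a\<close>, \<open>b\<close>, \<open>d\<close> are forced
    by the path. Under the hypotheses \<open>e\<close> gets colour 3 exactly when
    \<open>e = d\<close> or \<open>f = a\<close>, and \<open>f\<close> gets the other one, so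
    overlaps with the path agree.\<close>
  define s :: 3 where "s = (if e = a \<or> (e \<noteq> d \<and> f \<noteq> a) then 1 else 3)"
  define t :: 3 where "t = (if s = 1 then 3 else 1)"
  define \<phi> :: "'v \<Rightarrow> 3" where "\<phi> = (\<lambda>_. 2)(e := s, f := t, a := 1, d := 3)"
  have "\<phi> a = 1" "\<phi> b = 2" "\<phi> d = 3" using assms by (simp_all add: \<phi>_def)
  moreover have "\<phi> e = s"
    using assms by (cases "e = a"; cases "e = d") (simp_all add: \<phi>_def s_def)
  moreover have "\<phi> f = t"
    using assms by (cases "f = a"; cases "f = d") (auto simp: \<phi>_def s_def t_def)
  moreover have "{s, t} = {1, 3}" by (auto simp: s_def t_def)
  ultimately show ?thesis by (intro exI[of _ \<phi>]) simp
qed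

lemma edge_colouring_intersecting:
  assumes "card E1 = 2" "card E2 = 2" "card E3 = 2" "E1 \<noteq> E2"
    and "E1 \<inter> E2 \<inter> E3 = {}" "E1 \<inter> E2 \<noteq> {}"
  shows "\<exists>\<phi>::'v \<Rightarrow> 3. \<phi> ` E1 = {1, 2} \<and> \<phi> ` E2 = {2, 3} \<and> \<phi> ` E3 = {1, 3}"
proof -
  obtain b where b: "b \<in> E1" "b \<in> E2" using assms(6) by blast
  then have "b \<notin> E3" using assms(5) by blast
  obtain a where a: "E1 = {a, b}" "a \<noteq> b" using assms(1) b(1) by (auto simp: card_2_iff)
  obtain d where d: "E2 = {b, d}" "b \<noteq> d" using assms(2) b(2) by (auto simp: card_2_iff)
  obtain e f where ef: "E3 = {e, f}" "e \<noteq> f" using assms(3) by (auto simp: card_2_iff)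
  show ?thesis
    using path_colouring[of a b d e f] a d ef \<open>b \<notin> E3\<close> assms(4) by auto
qed

text \<open>Vertices stand for lines and edges for their intersection points. A colour is a
  coordinate line, so three distinct colour pairs make the points the three coordinate points. Edges
  through a common vertex are excluded because their points are collinear.\<close>

lemma edge_colouring:
  assumes "card E1 = 2" "card E2 = 2" "card E3 = 2" "E1 \<noteq> E2" "E1 \<noteq> E3" "E2 \<noteq> E3"
    and "E1 \<inter> E2 \<inter> E3 = {}"
  shows "\<exists>\<phi>::'v \<Rightarrow> 3. (card (\<phi> ` E1) = 2 \<and> card (\<phi> ` E2) = 2 \<and> card (\<phi> ` E3) = 2)
    \<and> \<phi> ` E1 \<noteq> \<phi> ` E2 \<and> \<phi> ` E1 \<noteq> \<phi> ` E3 \<and> \<phi> ` E2 \<noteq> \<phi> ` E3"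
proof -
  have I: "E1 \<inter> E3 \<inter> E2 = {}" "E2 \<inter> E3 \<inter> E1 = {}" using assms(7) by blast+
  have ne: "card {1::3, 2} = 2" "card {2::3, 3} = 2" "card {1::3, 3} = 2"
    "{1::3, 2} \<noteq> {2, 3}" "{1::3, 2} \<noteq> {1, 3}" "{2::3, 3} \<noteq> {1, 3}"
    by (auto simp: doubleton_eq_iff)
  consider "E1 \<inter> E2 \<noteq> {}" | "E1 \<inter> E3 \<noteq> {}" | "E2 \<inter> E3 \<noteq> {}"
    | "E1 \<inter> E2 = {}" "E1 \<inter> E3 = {}" "E2 \<inter> E3 = {}" by blast
  then show ?thesis
  proof cases
    case 1
    obtain \<phi> :: "'v \<Rightarrow> 3" where "\<phi> ` E1 = {1, 2}" "\<phi> ` E2 = {2, 3}" "\<phi> ` E3 = {1, 3}"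
      using edge_colouring_intersecting[OF assms(1,2,3,4,7) 1] by metis
    then show ?thesis using ne by (intro exI[of _ \<phi>]) simp
  next
    case 2
    obtain \<phi> :: "'v \<Rightarrow> 3" where "\<phi> ` E1 = {1, 2}" "\<phi> ` E3 = {2, 3}" "\<phi> ` E2 = {1, 3}"
      using edge_colouring_intersecting[OF assms(1,3,2,5) I(1) 2] by metis
    then show ?thesis using ne by (intro exI[of _ \<phi>]) simp
  next
    case 3
    obtain \<phi> :: "'v \<Rightarrow> 3" where "\<phi> ` E2 = {1, 2}" "\<phi> ` E3 = {2, 3}" "\<phi> ` E1 = {1, 3}"
      using edge_colouring_intersecting[OF assms(2,3,1,6) I(2) 3] by metis
    then show ?thesis using ne by (intro exI[of _ \<phi>]) simp
  next
    case 4
    obtain a b where ab: "E1 = {a, b}" "a \<noteq> b" using assms(1) by (auto simp: card_2_iff)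
    obtain c d where cd: "E2 = {c, d}" "c \<noteq> d" using assms(2) by (auto simp: card_2_iff)
    obtain e f where ef: "E3 = {e, f}" "e \<noteq> f" using assms(3) by (auto simp: card_2_iff)
    define \<phi> :: "'v \<Rightarrow> 3" where
      "\<phi> = (\<lambda>_. 1)(a := 1, b := 2, c := 2, d := 3, e := 1, f := 3)"
    have "a \<notin> {b, c, d, e, f}" "b \<notin> {c, d, e, f}" "c \<notin> {d, e, f}" "d \<notin> {e, f}" "e \<noteq> f"
      using 4 ab cd ef by blast+
    then have "\<phi> a = 1" "\<phi> b = 2" "\<phi> c = 2" "\<phi> d = 3" "\<phi> e = 1" "\<phi> f = 3"
      by (simp_all add: \<phi>_def)
    then have "\<phi> ` E1 = {1, 2}" "\<phi> ` E2 = {2, 3}" "\<phi> ` E3 = {1, 3}"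
      by (simp_all add: ab(1) cd(1) ef(1))
    then show ?thesis using ne by (intro exI[of _ \<phi>]) simp
  qed
qed

text \<open>Recording the pair of axes as the complement of \<open>z\<close> makes distinct pairs
  yield distinct coordinate points.\<close>

lemma ccross_axis:
  assumes "x \<noteq> (y::3)"
  shows "\<exists>s z. s \<noteq> 0 \<and> ccross (axis x 1) (axis y 1) = s *s (axis z 1 :: complex^3) \<and> {x, y} = UNIV - {z}"
proof -
  have U: "(UNIV::3 set) = {1, 2, 3}" using exhaust_3 by blast
  have "\<exists>s\<in>{1, -1}. \<exists>z\<in>{1, 2, 3}.
      ccross (axis x 1) (axis y 1) = s *s (axis z 1 :: complex^3) \<and> {x, y} = UNIV - {z}"
    using exhaust_3[of x] exhaust_3[of y] assms unfolding U
    by (elim disjE; simp add: vec3_simps axis_def; auto)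
  then obtain s :: complex and z :: 3 where "s \<in> {1, -1}"
    "ccross (axis x 1) (axis y 1) = s *s (axis z 1 :: complex^3) \<and> {x, y} = UNIV - {z}" by blast
  moreover from this(1) have "s \<noteq> 0" by auto
  ultimately show ?thesis by blast
qed

lemma triple_ccross_axis_nonzero:
  assumes "x1 \<noteq> y1" "x2 \<noteq> y2" "x3 \<noteq> (y3::3)"
    and "{x1, y1} \<noteq> {x2, y2}" "{x1, y1} \<noteq> {x3, y3}" "{x2, y2} \<noteq> {x3, y3}"
  shows "triple (ccross (axis x1 1) (axis y1 1)) (ccross (axis x2 1) (axis y2 1))
    (ccross (axis x3 1) (axis y3 1 :: complex^3)) \<noteq> 0"
proof -
  obtain s1 z1 where 1: "s1 \<noteq> 0" "ccross (axis x1 1) (axis y1 1) = s1 *s (axis z1 1 :: complex^3)"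
    "{x1, y1} = UNIV - {z1}" using ccross_axis[OF assms(1)] by blast
  obtain s2 z2 where 2: "s2 \<noteq> 0" "ccross (axis x2 1) (axis y2 1) = s2 *s (axis z2 1 :: complex^3)"
    "{x2, y2} = UNIV - {z2}" using ccross_axis[OF assms(2)] by blast
  obtain s3 z3 where 3: "s3 \<noteq> 0" "ccross (axis x3 1) (axis y3 1) = s3 *s (axis z3 1 :: complex^3)"
    "{x3, y3} = UNIV - {z3}" using ccross_axis[OF assms(3)] by blast
  have z: "z1 \<noteq> z2" "z1 \<noteq> z3" "z2 \<noteq> z3" using assms(4-6) 1(3) 2(3) 3(3) by auto
  have "triple (axis z1 1) (axis z2 1) (axis z3 1 :: complex^3) \<noteq> 0"
    using z exhaust_3[of z1] exhaust_3[of z2] exhaust_3[of z3]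
    by (elim disjE; simp add: triple_def cdot_def axis_def)
  moreover have "triple (s1 *s a) (s2 *s b) (s3 *s c) = s1 * s2 * s3 * triple a b c" for a b c :: "complex^3"
    by (simp add: vec3_simps algebra_simps)
  ultimately show ?thesis unfolding 1(2) 2(2) 3(2) using 1(1) 2(1) 3(1) by simp
qed

text \<open>A point of the configuration is the intersection of two lines; a point that is free on the line
  of its class is made one by adding a private line through it.\<close>

definition edge :: "nat rel \<Rightarrow> nat set \<Rightarrow> (nat set + nat set) set" where
  "edge R p = {Inl (R `` {Min p}), if (Min p, Max p) \<in> R then Inr p else Inl (R `` {Max p})}"

definition edge_point :: "nat \<Rightarrow> nat rel \<Rightarrow> (nat set + nat set \<Rightarrow> complex^3) \<Rightarrow> nat set \<Rightarrow> complex^3" where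
  "edge_point n R \<phi> = param n R (\<lambda>i. \<phi> (Inl (R `` {i}))) (\<lambda>p. \<phi> (Inr p)) (\<lambda>_. 1)"

lemma edge_point_in_stratum:
  assumes "equiv {1..n} R"
  shows "edge_point n R \<phi> \<in> stratum n R"
proof -
  have "const_on_classes R (\<lambda>i. \<phi> (Inl (R `` {i})))"
    using equiv_class_eq[OF assms] by (auto simp: const_on_classes_def)
  then show ?thesis unfolding edge_point_def stratum_def by blast
qed

lemma edge_cases:
  assumes R: "equiv {1..n} R" and p: "p \<in> pts n"
  obtains x y where "edge R p = {x, y}" "x \<noteq> y" "\<And>\<phi>. edge_point n R \<phi> p = ccross (\<phi> x) (\<phi> y)"
proof -
  obtain i j where ij: "i \<in> {1..n}" "j \<in> {1..n}" "p = {i, j}" "Min p = i" "Max p = j"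
    using p by (rule ptsE)
  show ?thesis
  proof (cases "(i, j) \<in> R")
    case True
    then show ?thesis using that[of "Inl (R `` {i})" "Inr p"] ij p
      by (simp add: edge_def edge_point_def param_def)
  next
    case False
    then have "R `` {i} \<noteq> R `` {j}" using eq_equiv_class_iff[OF R ij(1,2)] by blast
    then show ?thesis using that[of "Inl (R `` {i})" "Inl (R `` {j})"] ij p False
      by (simp add: edge_def edge_point_def param_def)
  qed
qed

lemma card_edge:
  assumes "equiv {1..n} R" "p \<in> pts n"
  shows "card (edge R p) = 2"
  using edge_cases[OF assms] by (metis card_2_iff)

text \<open>The third edge is arbitrary and need not come from a point of the configuration, so that
  the independence of two points can be obtained by adding an artificial third one.\<close>

lemma exists_edge_points_independent3:
  assumes R: "equiv {1..n} R" and p: "p \<in> pts n" "q \<in> pts n"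
    and E: "card E = 2" "edge R p \<noteq> edge R q" "edge R p \<noteq> E" "edge R q \<noteq> E"
      "edge R p \<inter> edge R q \<inter> E = {}"
  shows "\<exists>\<phi>. \<forall>x y. E = {x, y} \<longrightarrow>
    triple (edge_point n R \<phi> p) (edge_point n R \<phi> q) (ccross (\<phi> x) (\<phi> y)) \<noteq> 0"
proof -
  obtain c :: "nat set + nat set \<Rightarrow> 3" where
    c: "card (c ` edge R p) = 2" "card (c ` edge R q) = 2" "card (c ` E) = 2"
      "c ` edge R p \<noteq> c ` edge R q" "c ` edge R p \<noteq> c ` E" "c ` edge R q \<noteq> c ` E"
    using edge_colouring[OF card_edge[OF R p(1)] card_edge[OF R p(2)] E] by blast
  obtain x1 y1 where 1: "edge R p = {x1, y1}" "\<And>\<phi>. edge_point n R \<phi> p = ccross (\<phi> x1) (\<phi> y1)"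
    using edge_cases[OF R p(1)] by metis
  obtain x2 y2 where 2: "edge R q = {x2, y2}" "\<And>\<phi>. edge_point n R \<phi> q = ccross (\<phi> x2) (\<phi> y2)"
    using edge_cases[OF R p(2)] by metis
  have card2: "x \<noteq> y" if "card {x, y} = 2" for x y :: 3 using that by auto
  have "triple (edge_point n R (\<lambda>v. axis (c v) 1) p) (edge_point n R (\<lambda>v. axis (c v) 1) q)
      (ccross (axis (c x) 1) (axis (c y) 1)) \<noteq> 0" if "E = {x, y}" for x y
    unfolding 1(2) 2(2)
    by (rule triple_ccross_axis_nonzero) (use c 1(1) 2(1) that in \<open>auto intro!: card2\<close>)
  then show ?thesis by (intro exI[of _ "\<lambda>v. axis (c v) 1"]) blast
qed

lemma exists_stratum_triple_nonzero:
  assumes R: "equiv {1..n} R" and p: "p \<in> pts n" "q \<in> pts n" "r \<in> pts n"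
    and E: "edge R p \<noteq> edge R q" "edge R p \<noteq> edge R r" "edge R q \<noteq> edge R r"
      "edge R p \<inter> edge R q \<inter> edge R r = {}"
  shows "\<exists>\<gamma>\<in>stratum n R. triple (\<gamma> p) (\<gamma> q) (\<gamma> r) \<noteq> 0"
proof -
  obtain x y where "edge R r = {x, y}" "\<And>\<phi>. edge_point n R \<phi> r = ccross (\<phi> x) (\<phi> y)"
    using edge_cases[OF R p(3)] by metis
  then show ?thesis
    using exists_edge_points_independent3[OF R p(1,2) card_edge[OF R p(3)] E] edge_point_in_stratum[OF R]
    by metis
qed

lemma exists_stratum_ccross_nonzero:
  assumes R: "equiv {1..n} R" and p: "p \<in> pts n" "q \<in> pts n" and E: "edge R p \<noteq> edge R q"
  shows "\<exists>\<gamma>\<in>stratum n R. ccross (\<gamma> p) (\<gamma> q) \<noteq> 0"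
proof -
  \<comment> \<open>Neither \<open>{}\<close> nor \<open>{0}\<close> has two elements, so these
    vertices are on no edge of a point.\<close>
  let ?E = "{Inr {}, Inr {0}} :: (nat set + nat set) set"
  have "Inr {} \<notin> edge R p" "Inr {0} \<notin> edge R p" if "p \<in> pts n" for p
    using that by (auto simp: edge_def pts_def split: if_splits)
  then have E': "edge R p \<noteq> ?E" "edge R q \<noteq> ?E" "edge R p \<inter> edge R q \<inter> ?E = {}" using p by blast+
  have "card ?E = 2" by simp
  then obtain \<phi> where "triple (edge_point n R \<phi> p) (edge_point n R \<phi> q) (ccross (\<phi> (Inr {})) (\<phi> (Inr {0}))) \<noteq> 0"
    using exists_edge_points_independent3[OF R p _ E E'] by blast
  then have "ccross (edge_point n R \<phi> p) (edge_point n R \<phi> q) \<noteq> 0" by (auto simp: triple_def)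
  then show ?thesis using edge_point_in_stratum[OF R] by blast
qed

lemma exists_stratum_nonzero:
  assumes R: "equiv {1..n} R" and p: "p \<in> pts n"
  shows "\<exists>\<gamma>\<in>stratum n R. \<gamma> p \<noteq> 0"
proof -
  obtain x y where xy: "x \<noteq> y" "\<And>\<phi>. edge_point n R \<phi> p = ccross (\<phi> x) (\<phi> y)"
    using edge_cases[OF R p] by metis
  have "edge_point n R ((\<lambda>_. axis 1 1)(x := axis 2 1)) p \<noteq> 0"
    unfolding xy(2) using xy(1) by (simp add: vec3_eq_iff axis_def)
  then show ?thesis using edge_point_in_stratum[OF R] by blast
qed

text \<open>Independence is witnessed by a single nonvanishing coordinate, minor or determinant
  chosen at \<open>\<gamma>\<close>; four or more vectors are never independent.\<close>

lemma lin_indep_open: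
  assumes "finite S" "\<not> lin_dep_fam \<gamma> S"
  shows "\<exists>h\<in>poly_fun. h \<gamma> \<noteq> 0 \<and> (\<forall>\<delta>. h \<delta> \<noteq> 0 \<longrightarrow> \<not> lin_dep_fam \<delta> S)"
proof -
  have "card S < 4"
  proof (rule ccontr)
    assume "\<not> card S < 4"
    then obtain T where "T \<subseteq> S" "card T = 4" by (metis not_less obtain_subset_with_card_n)
    then show False using lin_dep_fam_quadruple lin_dep_fam_mono assms by blast
  qed
  then consider "card S = 0" | "card S = 1" | "card S = 2" | "card S = 3" by linarith
  then show ?thesis
  proof cases
    case 1
    then have "S = {}" using assms(1) by simp
    then show ?thesis
      by (intro bexI[of _ "\<lambda>_. 1"] poly_fun.pconst) (auto simp: lin_dep_fam_def)
  next
    case 2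
    then obtain p where S: "S = {p}" by (auto simp: card_1_singleton_iff)
    then obtain k where "\<gamma> p $ k \<noteq> 0" using assms(2) by (auto simp: lin_dep_fam_single vec_eq_iff)
    then show ?thesis
      by (intro bexI[of _ "\<lambda>\<gamma>. \<gamma> p $ k"] poly_fun.pcoord) (auto simp: S lin_dep_fam_single)
  next
    case 3
    then obtain p q where S: "S = {p, q}" "p \<noteq> q" by (auto simp: card_2_iff)
    then obtain k where "ccross (\<gamma> p) (\<gamma> q) $ k \<noteq> 0"
      using assms(2) by (auto simp: lin_dep_fam_pair vec_eq_iff[of "ccross _ _"])
    then show ?thesis
      by (intro bexI[of _ "\<lambda>\<gamma>. ccross (\<gamma> p) (\<gamma> q) $ k"] poly_fun_ccross)
        (auto simp: S lin_dep_fam_pair)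
  next
    case 4
    then obtain p q r where S: "S = {p, q, r}" "p \<noteq> q" "p \<noteq> r" "q \<noteq> r" by (auto simp: card_3_iff)
    then show ?thesis using assms(2)
      by (intro bexI[of _ "\<lambda>\<gamma>. triple (\<gamma> p) (\<gamma> q) (\<gamma> r)"] poly_fun_triple)
        (auto simp: lin_dep_fam_triple)
  qed
qed

section \<open>The matroids of partitions\<close>

text \<open>A third index \<open>k\<close> separates the lines through the point
  \<open>{i, k}\<close>. With two indices both lines would consist of the one point
  \<open>{1, 2}\<close>.\<close>

lemma inj_on_line:
  assumes "n \<ge> 3"
  shows "inj_on (line n) {1..n}"
proof (rule inj_onI, rule ccontr)
  fix i j assume ij: "i \<in> {1..n}" "j \<in> {1..n}" "line n i = line n j" "i \<noteq> j"
  have "card {i, j} < card {1..n}" using assms by (simp add: card_insert_if)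
  then have "\<not> {1..n} \<subseteq> {i, j}" by (metis card_mono finite.emptyI finite.insertI not_less)
  then obtain k where k: "k \<in> {1..n}" "k \<noteq> i" "k \<noteq> j" by blast
  have "{i, k} \<in> line n i" using pair_in_pts[of i n k] k ij(1) by (simp add: line_def)
  moreover have "{i, k} \<notin> line n j" using k ij(4) by (auto simp: line_def)
  ultimately show False using ij(3) by simp
qed

section \<open>Partitions of the lines as equivalence relations on indices\<close>

definition line_rel :: "nat \<Rightarrow> nat set set set set \<Rightarrow> nat rel" where
  "line_rel n Q = {(i, j). i \<in> {1..n} \<and> j \<in> {1..n} \<and> (\<exists>B\<in>Q. line n i \<in> B \<and> line n j \<in> B)}"

lemma partition_blocks:
  assumes "partition_on (lines n) Q"
  shows "\<And>i. i \<in> {1..n} \<Longrightarrow> \<exists>B\<in>Q. line n i \<in> B"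
    and "\<And>A B l. A \<in> Q \<Longrightarrow> B \<in> Q \<Longrightarrow> l \<in> A \<Longrightarrow> l \<in> B \<Longrightarrow> A = B"
    and "\<And>A l. A \<in> Q \<Longrightarrow> l \<in> A \<Longrightarrow> \<exists>i\<in>{1..n}. l = line n i"
    and "\<And>A. A \<in> Q \<Longrightarrow> A \<noteq> {}"
proof -
  have U: "line n ` {1..n} = \<Union>Q" using partition_onD1[OF assms] by (simp add: lines_def)
  show "\<exists>B\<in>Q. line n i \<in> B" if "i \<in> {1..n}" for i using imageI[OF that, of "line n"] unfolding U by blast
  show "A = B" if "A \<in> Q" "B \<in> Q" "l \<in> A" "l \<in> B" for A B l
    using partition_onD2[OF assms] that unfolding disjoint_def by blast
  show "\<exists>i\<in>{1..n}. l = line n i" if "A \<in> Q" "l \<in> A" for A l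
  proof -
    have "l \<in> line n ` {1..n}" unfolding U using that by blast
    then show ?thesis by blast
  qed
  show "A \<noteq> {}" if "A \<in> Q" for A using partition_onD3[OF assms] that by blast
qed

lemma equiv_line_rel:
  assumes "partition_on (lines n) Q"
  shows "equiv {1..n} (line_rel n Q)"
proof (rule equivI)
  show "line_rel n Q \<subseteq> {1..n} \<times> {1..n}" "sym (line_rel n Q)" by (auto simp: line_rel_def sym_def)
  show "refl_on {1..n} (line_rel n Q)"
    using partition_blocks(1)[OF assms] by (auto simp: line_rel_def refl_on_def)
  show "trans (line_rel n Q)"
  proof (rule transI)
    fix i j k assume "(i, j) \<in> line_rel n Q" "(j, k) \<in> line_rel n Q"
    then obtain A B where "A \<in> Q" "B \<in> Q" "line n i \<in> A" "line n j \<in> A" "line n j \<in> B" "line n k \<in> B"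
      and "i \<in> {1..n}" "k \<in> {1..n}" by (auto simp: line_rel_def)
    then show "(i, k) \<in> line_rel n Q" using partition_blocks(2)[OF assms] unfolding line_rel_def by blast
  qed
qed

lemma line_rel_class:
  assumes "partition_on (lines n) Q" "i \<in> {1..n}" "B \<in> Q" "line n i \<in> B"
  shows "line n ` (line_rel n Q `` {i}) = B"
proof (intro equalityI subsetI)
  fix l assume "l \<in> line n ` (line_rel n Q `` {i})"
  then obtain j C where "C \<in> Q" "line n i \<in> C" "line n j \<in> C" "l = line n j" by (auto simp: line_rel_def)
  then show "l \<in> B" using partition_blocks(2)[OF assms(1)] assms(3,4) by metis
next
  fix l assume l: "l \<in> B"
  then obtain j where "j \<in> {1..n}" "l = line n j" using partition_blocks(3)[OF assms(1,3)] by blast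
  then show "l \<in> line n ` (line_rel n Q `` {i})" using l assms by (auto simp: line_rel_def)
qed

text \<open>Recovers a partition from its relation, so that distinct partitions have distinct
  relations; irredundancy is transferred through this.\<close>

lemma partition_eq_line_rel_classes:
  assumes "partition_on (lines n) Q"
  shows "Q = (\<lambda>i. line n ` (line_rel n Q `` {i})) ` {1..n}"
proof (intro equalityI subsetI)
  fix B assume B: "B \<in> Q"
  then obtain l where l: "l \<in> B" using partition_blocks(4)[OF assms] by blast
  then obtain i where "i \<in> {1..n}" "l = line n i" using partition_blocks(3)[OF assms B] by blast
  then show "B \<in> (\<lambda>i. line n ` (line_rel n Q `` {i})) ` {1..n}" using line_rel_class[OF assms _ B] l by blast
next
  fix B assume "B \<in> (\<lambda>i. line n ` (line_rel n Q `` {i})) ` {1..n}"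
  then show "B \<in> Q" using partition_blocks(1)[OF assms] line_rel_class[OF assms] by force
qed

lemma admissible_iff_adm_rel:
  assumes n: "n \<ge> 3"
  shows "admissible n Q \<longleftrightarrow> partition_on (lines n) Q \<and> adm_rel n (line_rel n Q)"
proof (cases "partition_on (lines n) Q")
  case True
  have "card (line n ` (line_rel n Q `` {i})) = card (line_rel n Q `` {i})" for i
    by (intro card_image inj_on_subset[OF inj_on_line[OF n]]) (auto simp: line_rel_def)
  then have "(\<forall>A\<in>Q. card A \<notin> {2, 3, n - 1}) \<longleftrightarrow> (\<forall>i\<in>{1..n}. card (line_rel n Q `` {i}) \<notin> {2, 3, n - 1})"
    by (subst partition_eq_line_rel_classes[OF True]) simp
  then show ?thesis using True equiv_line_rel[OF True] by (simp add: admissible_def adm_rel_def)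
qed (simp add: admissible_def)

lemma exists_partition_line_rel:
  assumes n: "n \<ge> 3" and R: "equiv {1..n} R"
  shows "\<exists>Q. partition_on (lines n) Q \<and> line_rel n Q = R"
proof -
  define Q where "Q = (\<lambda>K. line n ` K) ` ({1..n} // R)"
  have "{} \<notin> Q" using in_quotient_imp_non_empty[OF R] by (auto simp: Q_def)
  then have part: "partition_on (lines n) Q"
    using partition_on_inj_image[OF partition_on_quotient[OF R] inj_on_line[OF n]]
    by (simp add: lines_def Q_def)
  have sub: "R \<subseteq> {1..n} \<times> {1..n}" using R by (simp add: equiv_def)
  have iff: "line n j \<in> line n ` (R `` {i}) \<longleftrightarrow> (i, j) \<in> R" if "j \<in> {1..n}" for i j
    using that sub by (subst inj_on_image_mem_iff[OF inj_on_line[OF n]]) auto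
  have "(i, j) \<in> line_rel n Q \<longleftrightarrow> (i, j) \<in> R" for i j
  proof
    assume "(i, j) \<in> line_rel n Q"
    then obtain k where ij: "i \<in> {1..n}" "j \<in> {1..n}" and
      "line n i \<in> line n ` (R `` {k})" "line n j \<in> line n ` (R `` {k})"
      by (auto simp: line_rel_def Q_def quotient_def)
    then have "(k, i) \<in> R" "(k, j) \<in> R" using iff by auto
    then show "(i, j) \<in> R" using R by (meson equiv_def symD transD)
  next
    assume ij: "(i, j) \<in> R"
    then have mem: "i \<in> {1..n}" "j \<in> {1..n}" using sub by auto
    then have "(i, i) \<in> R" using R by (simp add: equiv_def refl_on_def)
    then have "line n i \<in> line n ` (R `` {i})" "line n j \<in> line n ` (R `` {i})" using ij by auto
    moreover have "line n ` (R `` {i}) \<in> Q" using quotientI[OF mem(1), of R] unfolding Q_def by (rule imageI)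
    ultimately have "\<exists>B\<in>Q. line n i \<in> B \<and> line n j \<in> B"
      by (intro bexI[of _ "line n ` (R `` {i})"] conjI)
    then show "(i, j) \<in> line_rel n Q" using mem by (simp add: line_rel_def)
  qed
  then show ?thesis using part by auto
qed

lemma Union_block:
  assumes "partition_on (lines n) Q" "i \<in> {1..n}" "A \<in> Q" "line n i \<in> A"
  shows "\<Union>A = \<Union>(line n ` (line_rel n Q `` {i}))"
  using line_rel_class[OF assms] by simp

section \<open>Circuits of the partition matroid and generic points of a stratum\<close>

lemma type1E:
  assumes Q: "partition_on (lines n) Q" and t: "type1 n Q C"
  obtains i j k l where "C = {{i, j}, {k, l}}" "{i, j} \<noteq> {k, l}"
    "(i, k) \<in> line_rel n Q" "(j, l) \<in> line_rel n Q" "(i, j) \<notin> line_rel n Q"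
proof -
  from t obtain A B where C: "C \<subseteq> pts n" "card C = 2" and AB: "A \<in> Q" "B \<in> Q" "A \<noteq> B"
    and sub: "C \<subseteq> \<Union>A \<inter> \<Union>B" by (auto simp: type1_def)
  have *: "\<exists>i j. p = {i, j} \<and> i \<in> {1..n} \<and> j \<in> {1..n} \<and> line n i \<in> A \<and> line n j \<in> B" if p: "p \<in> C" for p
  proof -
    obtain a where a: "line n a \<in> A" "a \<in> {1..n}" "p \<in> line n a"
      using sub p partition_blocks(3)[OF Q AB(1)] by blast
    obtain b where b: "line n b \<in> B" "b \<in> {1..n}" "p \<in> line n b"
      using sub p partition_blocks(3)[OF Q AB(2)] by blast
    \<comment> \<open>Distinct blocks share no line, and a point lies on just two lines, so it is
      determined by one line from each block.\<close>
    have "a \<noteq> b" using a(1) b(1) AB partition_blocks(2)[OF Q AB(1,2)] by blast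
    moreover have "card p = 2" "a \<in> p" "b \<in> p" using a(3) b(3) by (auto simp: line_def pts_def)
    ultimately have "p = {a, b}" by (auto simp: card_2_iff)
    then show ?thesis using a b by blast
  qed
  obtain p q where pq: "C = {p, q}" "p \<noteq> q" using C(2) by (auto simp: card_2_iff)
  obtain i j where ij: "p = {i, j}" "i \<in> {1..n}" "j \<in> {1..n}" "line n i \<in> A" "line n j \<in> B"
    using *[of p] pq(1) by blast
  obtain k l where kl: "q = {k, l}" "k \<in> {1..n}" "l \<in> {1..n}" "line n k \<in> A" "line n l \<in> B"
    using *[of q] pq(1) by blast
  have "(i, k) \<in> line_rel n Q" "(j, l) \<in> line_rel n Q" using ij kl AB unfolding line_rel_def by blast+
  moreover have "(i, j) \<notin> line_rel n Q"
    using ij AB partition_blocks(2)[OF Q] unfolding line_rel_def by blast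
  ultimately show ?thesis using that pq ij(1) kl(1) by metis
qed

lemma type1I:
  assumes Q: "partition_on (lines n) Q" and p: "{i, j} \<in> pts n" "{k, l} \<in> pts n" "{i, j} \<noteq> {k, l}"
    and R: "(i, k) \<in> line_rel n Q" "(j, l) \<in> line_rel n Q" "(i, j) \<notin> line_rel n Q"
  shows "type1 n Q {{i, j}, {k, l}}"
proof -
  obtain A where A: "A \<in> Q" "line n i \<in> A" "line n k \<in> A" using R(1) by (auto simp: line_rel_def)
  obtain B where B: "B \<in> Q" "line n j \<in> B" "line n l \<in> B" using R(2) by (auto simp: line_rel_def)
  have "A \<noteq> B" using A B R by (auto simp: line_rel_def)
  moreover have "{i, j} \<in> line n i" "{i, j} \<in> line n j" "{k, l} \<in> line n k" "{k, l} \<in> line n l"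
    using p by (simp_all add: line_def)
  then have "{{i, j}, {k, l}} \<subseteq> \<Union>A \<inter> \<Union>B" using A(2,3) B(2,3) by blast
  ultimately show ?thesis using A(1) B(1) p unfolding type1_def by auto
qed

lemma lin_dep_stratum:
  assumes Q: "partition_on (lines n) Q" and \<gamma>: "\<gamma> \<in> stratum n (line_rel n Q)"
    and S: "dep_of n (circuit_LQ n Q) S"
  shows "lin_dep_fam \<gamma> S"
proof -
  note R = equiv_line_rel[OF Q]
  have symR: "sym (line_rel n Q)" using R by (simp add: equiv_def)
  from S obtain C where S': "S \<subseteq> pts n" "C \<subseteq> S" and "circuit_LQ n Q C" by (auto simp: dep_of_def)
  from \<open>circuit_LQ n Q C\<close> have "lin_dep_fam \<gamma> C" unfolding circuit_LQ_def
  proof (elim disjE)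
    assume t: "type1 n Q C"
    obtain i j k l where C: "C = {{i, j}, {k, l}}" "{i, j} \<noteq> {k, l}"
      and r: "(i, k) \<in> line_rel n Q" "(j, l) \<in> line_rel n Q" "(i, j) \<notin> line_rel n Q"
      using type1E[OF Q t] by metis
    have mem: "i \<in> {1..n}" "j \<in> {1..n}" "k \<in> {1..n}" "l \<in> {1..n}" using r by (auto simp: line_rel_def)
    have r': "(k, l) \<notin> line_rel n Q" using r R by (meson equiv_def symD transD)
    have ne: "i \<noteq> j" "k \<noteq> l" using r(3) r' R mem by (auto simp: equiv_def refl_on_def)
    obtain f u c where g: "\<gamma> = param n (line_rel n Q) f u c" and f: "const_on_classes (line_rel n Q) f"
      using \<gamma> by (auto simp: stratum_def)
    have "f k = f i" "f l = f j" using f r unfolding const_on_classes_def by metis+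
    then have "ccross (\<gamma> {i, j}) (\<gamma> {k, l}) = 0"
      unfolding g param_diff[OF symR mem(1,2) ne(1) r(3)] param_diff[OF symR mem(3,4) ne(2) r']
      by (simp add: ccross_scale)
    then show ?thesis unfolding C(1) using C(2) by (simp add: lin_dep_fam_pair)
  next
    assume t: "type2 n Q C"
    then obtain A where A: "A \<in> Q" "C \<subseteq> \<Union>A" "card C = 3" by (auto simp: type2_def)
    obtain i where i: "i \<in> {1..n}" "line n i \<in> A"
      using partition_blocks(3,4)[OF Q A(1)] by blast
    obtain p q r where "C = {p, q, r}" "p \<noteq> q" "p \<noteq> r" "q \<noteq> r" using A(3) by (auto simp: card_3_iff)
    moreover have "C \<subseteq> \<Union>(line n ` (line_rel n Q `` {i}))" using A(2) Union_block[OF Q i(1) A(1) i(2)] by simp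
    ultimately show ?thesis using stratum_line_triple_eq_0[OF \<gamma> symR] by (simp add: lin_dep_fam_triple)
  next
    assume "type3 n Q C"
    then show ?thesis by (intro lin_dep_fam_quadruple) (simp add: type3_def)
  qed
  then show ?thesis using S'(2) finite_subset[OF S'(1) finite_pts] by (rule lin_dep_fam_mono)
qed

text \<open>A private vertex is tagged with its own point, so equal edges of distinct points contain
  none: both points are intersections of the same two class lines.\<close>

lemma edge_eq_imp_type1:
  assumes Q: "partition_on (lines n) Q" and p: "p \<in> pts n" "q \<in> pts n" "p \<noteq> q"
    and e: "edge (line_rel n Q) p = edge (line_rel n Q) q"
  shows "type1 n Q {p, q}"
proof -
  let ?R = "line_rel n Q"
  note R = equiv_line_rel[OF Q]
  obtain i j where ij: "i \<in> {1..n}" "j \<in> {1..n}" "p = {i, j}" "Min p = i" "Max p = j"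
    using p(1) by (rule ptsE)
  obtain k l where kl: "k \<in> {1..n}" "l \<in> {1..n}" "q = {k, l}" "Min q = k" "Max q = l"
    using p(2) by (rule ptsE)
  have nR: "(i, j) \<notin> ?R" using e p(3) ij(4,5) by (auto simp: edge_def split: if_splits)
  have nR': "(k, l) \<notin> ?R" using e p(3) kl(4,5) by (auto simp: edge_def split: if_splits)
  have "{?R `` {i}, ?R `` {j}} = {?R `` {k}, ?R `` {l}}"
    using e nR nR' unfolding edge_def ij(4,5) kl(4,5) by (auto simp: doubleton_eq_iff)
  then consider "?R `` {i} = ?R `` {k}" "?R `` {j} = ?R `` {l}" | "?R `` {i} = ?R `` {l}" "?R `` {j} = ?R `` {k}"
    by (auto simp: doubleton_eq_iff)
  then show ?thesis
  proof cases
    case 1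
    then have "(i, k) \<in> ?R" "(j, l) \<in> ?R" using eq_equiv_class_iff[OF R] ij kl by blast+
    then show ?thesis using type1I[OF Q, of i j k l] p ij(3) kl(3) nR by simp
  next
    case 2
    then have "(i, l) \<in> ?R" "(j, k) \<in> ?R" using eq_equiv_class_iff[OF R] ij kl by blast+
    then show ?thesis using type1I[OF Q, of i j l k] p ij(3) kl(3) nR by (simp add: insert_commute)
  qed
qed

text \<open>A vertex shared by distinct points cannot be private, hence is a class, and all three
  points lie on lines of its block.\<close>

lemma edge_common_imp_block:
  assumes Q: "partition_on (lines n) Q" and p: "p \<in> pts n" "q \<in> pts n" "r \<in> pts n" "p \<noteq> q"
    and v: "v \<in> edge (line_rel n Q) p" "v \<in> edge (line_rel n Q) q" "v \<in> edge (line_rel n Q) r"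
  shows "\<exists>A\<in>Q. {p, q, r} \<subseteq> \<Union>A"
proof -
  have Inr: "s = p" if "Inr s \<in> edge (line_rel n Q) p" for s p
    using that by (auto simp: edge_def split: if_splits)
  have Inl: "\<exists>i\<in>{1..n}. p \<in> line n i \<and> K = line_rel n Q `` {i}" if v: "Inl K \<in> edge (line_rel n Q) p" "p \<in> pts n" for K p
  proof -
    obtain i j where "i \<in> {1..n}" "j \<in> {1..n}" "p = {i, j}" "Min p = i" "Max p = j"
      using v(2) by (rule ptsE)
    then show ?thesis using v by (auto simp: edge_def line_def split: if_splits)
  qed
  obtain K where K: "v = Inl K"
    using Inr v(1,2) p(4) by (cases v) blast+
  obtain i where i: "i \<in> {1..n}" "p \<in> line n i" "K = line_rel n Q `` {i}" using Inl v(1) p(1) K by blast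
  obtain A where A: "A \<in> Q" "line n i \<in> A" using partition_blocks(1)[OF Q i(1)] by blast
  have "x \<in> \<Union>A" if x: "Inl K \<in> edge (line_rel n Q) x" "x \<in> pts n" for x
  proof -
    obtain j where j: "j \<in> {1..n}" "x \<in> line n j" "K = line_rel n Q `` {j}" using Inl x by blast
    then have "(i, j) \<in> line_rel n Q" using i eq_equiv_class_iff[OF equiv_line_rel[OF Q]] by blast
    then show ?thesis using j(2) Union_block[OF Q i(1) A] by auto
  qed
  then show ?thesis using A(1) v p K by blast
qed

text \<open>The absence of circuits translates into the conditions of the colouring: type 3 bounds
  the size by three, type 1 makes the edges distinct, and type 2 rules out a common vertex.\<close>

lemma exists_stratum_lin_indep:
  assumes Q: "partition_on (lines n) Q" and S: "S \<subseteq> pts n" "\<not> dep_of n (circuit_LQ n Q) S"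
  shows "\<exists>\<gamma>\<in>stratum n (line_rel n Q). \<not> lin_dep_fam \<gamma> S"
proof -
  note R = equiv_line_rel[OF Q]
  have nt: "\<not> type1 n Q C" "\<not> type2 n Q C" "\<not> type3 n Q C" if "C \<subseteq> S" for C
    using S that by (auto simp: dep_of_def circuit_LQ_def)
  have fin: "finite S" using S(1) finite_pts by (rule finite_subset)
  have "card S < 4"
  proof (rule ccontr)
    assume "\<not> card S < 4"
    then obtain T where T: "T \<subseteq> S" "card T = 4" by (metis not_less obtain_subset_with_card_n)
    then have "type3 n Q T" using S(1) nt unfolding type3_def by (meson subset_trans)
    then show False using nt T(1) by blast
  qed
  have edge: "edge (line_rel n Q) p \<noteq> edge (line_rel n Q) q" if "p \<in> S" "q \<in> S" "p \<noteq> q" for p q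
    using edge_eq_imp_type1[OF Q _ _ that(3)] nt(1)[of "{p, q}"] that S(1) by blast
  from \<open>card S < 4\<close> consider "card S = 0" | "card S = 1" | "card S = 2" | "card S = 3" by linarith
  then show ?thesis
  proof cases
    case 1
    then have "S = {}" using fin by simp
    then show ?thesis using stratum_nonempty by (auto simp: lin_dep_fam_def)
  next
    case 2
    then obtain p where "S = {p}" by (auto simp: card_1_singleton_iff)
    then show ?thesis using exists_stratum_nonzero[OF R] S(1) by (simp add: lin_dep_fam_single)
  next
    case 3
    then obtain p q where pq: "S = {p, q}" "p \<noteq> q" by (auto simp: card_2_iff)
    then show ?thesis using exists_stratum_ccross_nonzero[OF R] S(1) edge by (simp add: lin_dep_fam_pair)
  next
    case 4
    then obtain p q r where pqr: "S = {p, q, r}" "p \<noteq> q" "p \<noteq> r" "q \<noteq> r" by (auto simp: card_3_iff)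
    then have p: "p \<in> pts n" "q \<in> pts n" "r \<in> pts n" using S(1) by auto
    have "edge (line_rel n Q) p \<inter> edge (line_rel n Q) q \<inter> edge (line_rel n Q) r = {}"
    proof (rule ccontr)
      assume "\<not> ?thesis"
      then obtain v where v: "v \<in> edge (line_rel n Q) p" "v \<in> edge (line_rel n Q) q" "v \<in> edge (line_rel n Q) r"
        by blast
      obtain A where "A \<in> Q" "S \<subseteq> \<Union>A"
        using edge_common_imp_block[OF Q p pqr(2) v] unfolding pqr(1) by (rule bexE)
      then have "type2 n Q S" using S(1) 4 nt(1) by (auto simp: type2_def)
      then show False using nt(2) by blast
    qed
    then obtain \<gamma> where "\<gamma> \<in> stratum n (line_rel n Q)" "triple (\<gamma> p) (\<gamma> q) (\<gamma> r) \<noteq> 0"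
      using exists_stratum_triple_nonzero[OF R p] edge pqr by blast
    then show ?thesis using pqr by (auto simp: lin_dep_fam_triple)
  qed
qed

section \<open>Strata and sets of realizations have the same closure\<close>

lemma stratum_subset_zclosure_realizations:
  assumes Q: "partition_on (lines n) Q"
  shows "stratum n (line_rel n Q) \<subseteq> zclosure n (realizations n (dep_of n (circuit_LQ n Q)))"
proof -
  let ?I = "{S. S \<subseteq> pts n \<and> \<not> dep_of n (circuit_LQ n Q) S}"
  \<comment> \<open>Each of the finitely many independent sets imposes a nonempty open condition on
    the stratum. A generic point meets all of them at once, and the required dependencies hold at
    every point of the stratum.\<close>
  have "\<forall>S\<in>?I. \<exists>h. h \<in> poly_fun \<and> (\<exists>\<gamma>\<in>stratum n (line_rel n Q). h \<gamma> \<noteq> 0) \<and> (\<forall>\<delta>. h \<delta> \<noteq> 0 \<longrightarrow> \<not> lin_dep_fam \<delta> S)"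
  proof
    fix S assume S: "S \<in> ?I"
    then obtain \<gamma> where \<gamma>: "\<gamma> \<in> stratum n (line_rel n Q)" "\<not> lin_dep_fam \<gamma> S"
      using exists_stratum_lin_indep[OF Q] by blast
    moreover have "finite S" using S finite_subset[OF _ finite_pts] by blast
    ultimately show "\<exists>h. h \<in> poly_fun \<and> (\<exists>\<gamma>\<in>stratum n (line_rel n Q). h \<gamma> \<noteq> 0) \<and> (\<forall>\<delta>. h \<delta> \<noteq> 0 \<longrightarrow> \<not> lin_dep_fam \<delta> S)"
      using lin_indep_open[of S \<gamma>] by blast
  qed
  from bchoice[OF this] obtain h where h: "\<And>S. S \<in> ?I \<Longrightarrow> h S \<in> poly_fun"
    "\<And>S. S \<in> ?I \<Longrightarrow> \<exists>\<gamma>\<in>stratum n (line_rel n Q). h S \<gamma> \<noteq> 0"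
    "\<And>S \<delta>. S \<in> ?I \<Longrightarrow> h S \<delta> \<noteq> 0 \<Longrightarrow> \<not> lin_dep_fam \<delta> S"
    by auto
  have "finite ?I" by (rule finite_subset[of _ "Pow (pts n)"]) (auto simp: finite_pts)
  then have "stratum n (line_rel n Q) \<subseteq> zclosure n {x \<in> stratum n (line_rel n Q). \<forall>f\<in>h ` ?I. f x \<noteq> 0}"
    using h(1,2) by (intro curve_connected_generic_dense[OF stratum_curve_connected stratum_subset_ambient]) auto
  also have "\<dots> \<subseteq> zclosure n (realizations n (dep_of n (circuit_LQ n Q)))"
  proof (rule zclosure_mono, rule subsetI)
    fix x assume x: "x \<in> {x \<in> stratum n (line_rel n Q). \<forall>f\<in>h ` ?I. f x \<noteq> 0}"
    have "lin_dep_fam x S \<longleftrightarrow> dep_of n (circuit_LQ n Q) S" if "S \<subseteq> pts n" for S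
    proof
      assume "lin_dep_fam x S"
      then have "S \<notin> ?I" using h(3)[of S x] x by blast
      then show "dep_of n (circuit_LQ n Q) S" using that by simp
    qed (use x lin_dep_stratum[OF Q] in blast)
    then show "x \<in> realizations n (dep_of n (circuit_LQ n Q))"
      using x stratum_subset_ambient by (auto simp: realizations_def)
  qed
  finally show ?thesis .
qed

text \<open>The danger is that covectors of two blocks are proportional in a realization. All points
  on two lines from these blocks would then be collinear, although admissibility provides an
  independent triple among them.\<close>

lemma realizations_subset_stratum:
  assumes Q: "partition_on (lines n) Q" and adm_rel: "adm_rel n (line_rel n Q)" and n: "n \<ge> 4"
  shows "realizations n (dep_of n (circuit_LQ n Q)) \<subseteq> stratum n (line_rel n Q)"
proof
  let ?R = "line_rel n Q"
  note R = equiv_line_rel[OF Q]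
  fix \<gamma> assume "\<gamma> \<in> realizations n (dep_of n (circuit_LQ n Q))"
  then have amb: "\<gamma> \<in> ambient n" and
    dep: "\<And>S. S \<subseteq> pts n \<Longrightarrow> lin_dep_fam \<gamma> S \<longleftrightarrow> dep_of n (circuit_LQ n Q) S"
    by (auto simp: realizations_def)
  \<comment> \<open>The covector is chosen for a set of indices rather than for an index, which
    makes it constant on classes.\<close>
  define g where "g K = (SOME h. h \<noteq> 0 \<and> (\<forall>p\<in>\<Union>(line n ` K). cdot h (\<gamma> p) = 0))" for K
  have g: "g (?R `` {i}) \<noteq> 0 \<and> (\<forall>p\<in>\<Union>(line n ` (?R `` {i})). cdot (g (?R `` {i})) (\<gamma> p) = 0)"
    if i: "i \<in> {1..n}" for i
    unfolding g_def
  proof (rule someI_ex, rule exists_orthogonal)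
    fix p q r assume p: "p \<in> \<Union>(line n ` (?R `` {i}))" "q \<in> \<Union>(line n ` (?R `` {i}))"
      "r \<in> \<Union>(line n ` (?R `` {i}))"
    obtain A where A: "A \<in> Q" "line n i \<in> A" using partition_blocks(1)[OF Q i] by blast
    show "triple (\<gamma> p) (\<gamma> q) (\<gamma> r) = 0"
    proof (cases "p \<noteq> q \<and> p \<noteq> r \<and> q \<noteq> r")
      case True
      have sub: "{p, q, r} \<subseteq> \<Union>A" using p Union_block[OF Q i A] by auto
      have pts: "{p, q, r} \<subseteq> pts n" using p by (auto simp: line_def)
      have "card {p, q, r} = 3" using True by simp
      then have "(\<exists>D\<subseteq>{p, q, r}. type1 n Q D) \<or> type2 n Q {p, q, r}"
        unfolding type2_def using sub pts A(1) by (metis (no_types, lifting))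
      then have "\<exists>D\<subseteq>{p, q, r}. circuit_LQ n Q D"
        unfolding circuit_LQ_def by (meson order_refl)
      then have "dep_of n (circuit_LQ n Q) {p, q, r}"
        using pts unfolding dep_of_def by (intro conjI)
      then show ?thesis using dep[OF pts] True by (simp add: lin_dep_fam_triple)
    qed auto
  qed
  define f where "f i = g (?R `` {i})" for i
  have f0: "f i \<noteq> 0" if "i \<in> {1..n}" for i using g[OF that] by (simp add: f_def)
  have f: "cdot (f i) (\<gamma> p) = 0" if "i \<in> {1..n}" "p \<in> line n i" for i p
    using g[OF that(1)] that equiv_class_self[OF R that(1)] unfolding f_def by blast
  have nonparallel: "ccross (f i) (f j) \<noteq> 0" if ij: "i \<in> {1..n}" "j \<in> {1..n}" "(i, j) \<notin> ?R" for i j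
  proof
    assume "ccross (f i) (f j) = 0"
    then obtain s where s: "f j = s *s f i" using parallel_of_ccross_eq_0 f0[OF ij(1)] by blast
    then have "s \<noteq> 0" using f0[OF ij(2)] by auto
    then have orth: "cdot (f i) (\<gamma> p) = 0" if "p \<in> line n i \<union> line n j" for p
      using that f[OF ij(1)] f[OF ij(2)] by (auto simp: s cdot_scale)
    \<comment> \<open>Independence at one point \<open>\<delta>\<close> of the stratum certifies
      independence in the matroid, since by \<open>lin_dep_stratum\<close> every dependent set of
      the matroid is dependent at \<open>\<delta>\<close>.\<close>
    obtain p q r \<delta> where p: "p \<in> line n i \<union> line n j" "q \<in> line n i \<union> line n j" "r \<in> line n i \<union> line n j"
      and \<delta>: "\<delta> \<in> stratum n ?R" "triple (\<delta> p) (\<delta> q) (\<delta> r) \<noteq> 0"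
      using exists_independent_lines[OF adm_rel n ij] by blast
    have d: "p \<noteq> q" "p \<noteq> r" "q \<noteq> r" using \<delta>(2) by auto
    have pts: "{p, q, r} \<subseteq> pts n" using p by (auto simp: line_def)
    have "triple (\<gamma> p) (\<gamma> q) (\<gamma> r) = 0"
      using f0[OF ij(1)] orth p by (intro triple_eq_0_of_orthogonal[of "f i"]) auto
    then have "dep_of n (circuit_LQ n Q) {p, q, r}" using dep[OF pts] d by (simp add: lin_dep_fam_triple)
    then have "lin_dep_fam \<delta> {p, q, r}" by (rule lin_dep_stratum[OF Q \<delta>(1)])
    then show False using \<delta>(2) d by (simp add: lin_dep_fam_triple)
  qed
  show "\<gamma> \<in> stratum n ?R"
  proof (rule stratumI[OF amb])
    show "const_on_classes ?R f"
      using equiv_class_eq[OF R] by (simp add: const_on_classes_def f_def)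
  next
    fix i j assume ij: "i \<in> {1..n}" "j \<in> {1..n}" "i < j"
    then have l: "{i, j} \<in> line n i" "{i, j} \<in> line n j" using pair_in_pts[of i n j] by (auto simp: line_def)
    show "\<exists>u. \<gamma> {i, j} = ccross (f i) u"
      using f0[OF ij(1)] f[OF ij(1) l(1)] by (metis ccross_of_orthogonal)
    show "\<exists>c. \<gamma> {i, j} = c *s ccross (f i) (f j)" if "(i, j) \<notin> ?R"
      using nonparallel[OF ij(1,2) that] f[OF ij(1) l(1)] f[OF ij(2) l(2)]
      by (metis scale_ccross_of_orthogonal)
  qed
qed

lemma V_LQ_eq_zclosure_stratum:
  assumes "admissible n Q" "n \<ge> 4"
  shows "V_LQ n Q = zclosure n (stratum n (line_rel n Q))"
proof -
  have Q: "partition_on (lines n) Q" "adm_rel n (line_rel n Q)" using assms admissible_iff_adm_rel[of n Q] by auto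
  have "realizations n (dep_of n (circuit_LQ n Q)) \<subseteq> ambient n" by (auto simp: realizations_def)
  then show ?thesis unfolding V_LQ_def
    using zclosure_mono[OF realizations_subset_stratum[OF Q assms(2)]]
      zclosure_trans[OF stratum_subset_zclosure_realizations[OF Q(1)]] by blast
qed

theorem theorem6p5:
  fixes n :: nat
  assumes "n \<ge> 4"
  shows "V_circ_L n = (\<Union>Q\<in>{Q. admissible n Q}. V_LQ n Q)
    \<and> (\<forall>Q. admissible n Q \<longrightarrow> zirreducible n (V_LQ n Q))
    \<and> (\<forall>Q Q'. admissible n Q \<longrightarrow> admissible n Q' \<longrightarrow> Q \<noteq> Q' \<longrightarrow> \<not> V_LQ n Q \<subseteq> V_LQ n Q')"
proof (intro conjI allI impI)
  have n3: "n \<ge> 3" using assms by simp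
  note V_LQ = V_LQ_eq_zclosure_stratum[OF _ assms]
  show "V_circ_L n = (\<Union>Q\<in>{Q. admissible n Q}. V_LQ n Q)"
  proof (intro equalityI subsetI)
    fix \<gamma> assume "\<gamma> \<in> V_circ_L n"
    then obtain R where "equiv {1..n} R" "\<gamma> \<in> stratum n R" using V_circ_L_subset_stratum by blast
    then obtain R' where R': "adm_rel n R'" "\<gamma> \<in> zclosure n (stratum n R')"
      using stratum_subset_zclosure_adm_rel[OF assms] by blast
    obtain Q where "partition_on (lines n) Q" "line_rel n Q = R'"
      using exists_partition_line_rel[OF n3] R'(1) by (auto simp: adm_rel_def)
    then have "admissible n Q" "\<gamma> \<in> V_LQ n Q" using R' admissible_iff_adm_rel[OF n3] V_LQ by auto
    then show "\<gamma> \<in> (\<Union>Q\<in>{Q. admissible n Q}. V_LQ n Q)" by blast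
  next
    fix \<gamma> assume "\<gamma> \<in> (\<Union>Q\<in>{Q. admissible n Q}. V_LQ n Q)"
    then obtain Q where Q: "admissible n Q" "\<gamma> \<in> zclosure n (stratum n (line_rel n Q))" using V_LQ by auto
    then have "equiv {1..n} (line_rel n Q)" unfolding admissible_def by (blast intro: equiv_line_rel)
    then show "\<gamma> \<in> V_circ_L n"
      using zclosure_minimal[OF zclosed_V_circ_L stratum_subset_V_circ_L] Q(2) by blast
  qed
  show "zirreducible n (V_LQ n Q)" if "admissible n Q" for Q
    unfolding V_LQ[OF that]
    by (rule zirreducible_zclosure_curve_connected[OF stratum_curve_connected stratum_subset_ambient stratum_nonempty])
  fix Q Q' assume Q: "admissible n Q" and Q': "admissible n Q'" and "Q \<noteq> Q'"
  have part: "partition_on (lines n) Q" "partition_on (lines n) Q'" using Q Q' by (auto simp: admissible_def)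
  show "\<not> V_LQ n Q \<subseteq> V_LQ n Q'"
  proof
    assume "V_LQ n Q \<subseteq> V_LQ n Q'"
    then have "stratum n (line_rel n Q) \<subseteq> zclosure n (stratum n (line_rel n Q'))"
      using V_LQ[OF Q] V_LQ[OF Q'] zclosure_superset by blast
    moreover have "adm_rel n (line_rel n Q)" using Q admissible_iff_adm_rel[OF n3] by blast
    ultimately have "line_rel n Q = line_rel n Q'" using adm_rel_eqI equiv_line_rel[OF part(2)] assms by blast
    then show False
      using partition_eq_line_rel_classes[OF part(1)] partition_eq_line_rel_classes[OF part(2)] \<open>Q \<noteq> Q'\<close> by simp
  qed
qed

end
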